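(* Let $G$ be a group with a ramification data $\mathfrak{r}=\sum_{C\in\mathcal{C}}\mathfrak{r}_C C$, and let $K$ be an arbitrary field. Then the following statements hold: (1) $\Delta_{G,\mathfrak{r}}$ is a connected component of $\Gamma_{G,\mathfrak{r}}$, and $\Gamma_{G,\mathfrak{r}}=\bigsqcup_{i\in G/\Delta^0_{G,\mathfrak{r}}}\Omega_i$, where each $\Omega_i$ is isomorphic to $\Delta_{G,\mathfrak{r}}$ as graphs. (2) $\Lambda_{G,\mathfrak{r}}$ is a strongly connected component of $\Delta_{G,\mathfrak{r}}$, and $\Pi\cong\Lambda_{G,\mathfrak{r}}$ as graphs for every strongly connected component $\Pi$ of $\Delta_{G,\mathfrak{r}}$. Furthermore, $|\mathcal{S}_{\Delta_{G,\mathfrak{r}}}|=|\Delta^0_{G,\mathfrak{r}}/\Lambda^0_{G,\mathfrak{r}}|$ if $S_{G,\mathfrak{r}}$ is a submonoid of $G$, and $|\mathcal{S}_{\Delta_{G,\mathfrak{r}}}|=|\Delta^0_{G,\mathfrak{r}}|$ otherwise. (3) $\Delta_{G,\mathfrak{r}}$ is a strongly connected component of $\Gamma_{G,\mathfrak{r}}$ if and only if $\mathfrak{r}=0$ or $S_{G,\mathfrak{r}}$ is a subgroup of $G$. Consequently, if $S_{G,\mathfrak{r}}$ is finite, then $\Delta_{G,\mathfrak{r}}$ is a strongly connected component of $\Gamma_{G,\mathfrak{r}}$. (4) If, in addition, $G$ is commutative, then $(\mathcal{S}_{\Delta_{G,\mathfrak{r}}},\geq)$ is downward directed. (5) $L_K(\Gamma_{G,\mathfrak{r}})\cong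 L_K(\Delta_{G,\mathfrak{r}})^{(G/\Delta^0_{G,\mathfrak{r}})}$, where $A^{(X)}$ denotes the direct sum of copies of $A$ indexed by the set $X$.
   Context: Graphs. A (directed) graph $E=(E^0,E^1,r,s)$ consists of disjoint sets $E^0$ (vertices) and $E^1$ (edges) and maps $r,s:E^1\to E^0$ (range, source); multiple edges, loops and infinite graphs are allowed. A path is a sequence of edges $e_1\cdots e_n$ with $r(e_i)=s(e_{i+1})$, starting at $s(e_1)$ and ending at $r(e_n)$; vertices are paths of length $0$. The extended graph $\widehat{E}$ is obtained from $E$ by adding, for each $e\in E^1$, an edge $e^*$ from $r(e)$ to $s(e)$. $E$ is connected if for any two vertices $u,v$ there is a path in $\widehat{E}$ from $u$ to $v$; the connected components of $E$ are the connected graphs whose disjoint union is $E$. $E$ is strongly connected if for every pair of vertices $(u,v)$ there is a path in $E$ from $u$ to $v$. For vertices $v,w$ write $v\ge w$ if there is a path in $E$ from $v$ to $w$. A strongly connected component of $E$ is the full subgraph on an equivalence class of vertices under the relation "$v\ge w$ and $w\ge v$". $\mathcal{S}_E$ is the set of strongly connected components of $E$, partially ordered by: $\Pi_1\ge\Pi_2$ if $v\ge w$ for some $v\in\Pi_1^0$ and $w\in\Pi_2^0$. A partially ordered set is downward directed if any two elements have a common lower bound. The trivial graph has one vertex and no edges. Leavitt path algebra. For a field $K$ and a graph $E$, $L_K(E)$ is the (not necessarily unital) associative $K$-algebra generated by $E^0\cup E^1\cup\{e^*: e\in E^1\}$ subject to, for all $v,w\in E^0$ and $e,f\in E^1$: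 (i) $vw=\delta_{v,w}w$; (ii) $s(e)e=e=e\,r(e)$ and $r(e)e^*=e^*=e^*s(e)$; (iii) $e^*f=\delta_{e,f}r(e)$; (iv) $v=\sum_{e\in s^{-1}(v)}ee^*$ for every vertex $v$ with $0<|s^{-1}(v)|<\infty$. Hopf graphs. Let $G$ be a group and $\mathcal{C}$ its set of conjugacy classes. A ramification data of $G$ is a function $\mathfrak{r}:\mathcal{C}\to\mathbb{N}=\{0,1,2,\dots\}$, written $\mathfrak{r}=\sum_{C\in\mathcal{C}}\mathfrak{r}_C C$ with $\mathfrak{r}_C=\mathfrak{r}(C)$; its support is $\mathrm{supp}(\mathfrak{r})=\{C\in\mathcal{C}:\mathfrak{r}_C>0\}$. The Hopf graph $\Gamma_{G,\mathfrak{r}}$ has vertex set $G$ and, for each $x\in G$, $C\in\mathcal{C}$ and $c\in C$, exactly $\mathfrak{r}_C$ edges from $x$ to $xc$. $S_{G,\mathfrak{r}}$ is the subsemigroup of $G$ generated by $\bigcup_{C\in\mathrm{supp}(\mathfrak{r})}C$ (empty if $\mathfrak{r}=0$); it is a submonoid of $G$ if it contains $1_G$. $\langle S_{G,\mathfrak{r}}\rangle$ is the subgroup of $G$ generated by $S_{G,\mathfrak{r}}$. The subgraph $\Delta_{G,\mathfrak{r}}$ of $\Gamma_{G,\mathfrak{r}}$: if $\mathfrak{r}=0$ it is the trivial graph (with vertex $1_G$); otherwise it has vertex set $\Delta^0_{G,\mathfrak{r}}=\langle S_{G,\mathfrak{r}}\rangle$ and edge set $r^{-1}(\Delta^0_{G,\mathfrak{r}})$,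 with the restricted range and source maps. The subgraph $\Lambda_{G,\mathfrak{r}}$ of $\Gamma_{G,\mathfrak{r}}$: if $S_{G,\mathfrak{r}}$ is not a submonoid of $G$ it is the trivial graph (with vertex $1_G$); otherwise its vertex set $\Lambda^0_{G,\mathfrak{r}}$ is the maximal (i.e. largest) subgroup of $G$ contained in $S_{G,\mathfrak{r}}$ and its edge set is $r^{-1}(\Lambda^0_{G,\mathfrak{r}})\cap s^{-1}(\Lambda^0_{G,\mathfrak{r}})$. Both $\Delta^0_{G,\mathfrak{r}}$ and $\Lambda^0_{G,\mathfrak{r}}$ are normal subgroups of $G$. *)

theory Defs
  imports
    "HOL-Algebra.QuotRing"
    "HOL-Algebra.Generated_Groups"
    "HOL-Algebra.Module"
    "HOL-Library.Poly_Mapping"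
    "HOL-Library.Equipollence"
    "HOL-Library.Disjoint_Sets"
    "Graph_Theory.Digraph_Isomorphism"
begin

section \<open>Graphs\<close>

text \<open>
  Graphs are \<^typ>\<open>('v, 'e) pre_digraph\<close>s, with source map \<^const>\<open>tail\<close> and range map \<^const>\<open>head\<close>.
  These maps are total on the edge type, and a subgraph keeps the maps of the ambient graph; what
  they do outside \<^const>\<open>arcs\<close> is irrelevant.

  \<^const>\<open>connected\<close> means that any two vertices are joined by a path in \<^const>\<open>mk_symmetric\<close>, whose
  edges are the pairs (s(e), r(e)) and (r(e), s(e)), that is, the extended graph up to parallel
  edges. It entails that there is at least one vertex.
\<close>

definition is_disjoint_union ::
    "('v, 'e) pre_digraph \<Rightarrow> 'i set \<Rightarrow> ('i \<Rightarrow> ('v, 'e) pre_digraph) \<Rightarrow> bool" where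
  "is_disjoint_union E I \<Omega> \<longleftrightarrow>
     (\<forall>i\<in>I. subgraph (\<Omega> i) E) \<and>
     disjoint_family_on (\<lambda>i. verts (\<Omega> i)) I \<and>
     E = pre_digraph.Union E (\<Omega> ` I)"

definition connected_components :: "('v, 'e) pre_digraph \<Rightarrow> ('v, 'e) pre_digraph set" where
  "connected_components E =
     {H. \<exists>\<H>. H \<in> \<H> \<and> (\<forall>H'\<in>\<H>. connected H') \<and> is_disjoint_union E \<H> (\<lambda>H'. H')}"

text \<open>
  The library's \<^const>\<open>pre_digraph.sccs\<close> are the maximal strongly connected induced subgraphs, which
  are the full subgraphs on the classes of mutually reachable vertices:
\<close>

lemma (in wf_digraph) sccs_eq_induced_on_classes:
  "sccs = (\<lambda>u. G \<restriction> {v. u \<rightarrow>\<^sup>* v \<and> v \<rightarrow>\<^sup>* u}) ` verts G"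
  unfolding sccs_conv_sccs_verts sccs_verts_conv_scc_of image_image scc_of_def ..

definition scc_ge ::
    "('v, 'e) pre_digraph \<Rightarrow> ('v, 'e) pre_digraph \<Rightarrow> ('v, 'e) pre_digraph \<Rightarrow> bool" where
  "scc_ge E P\<^sub>1 P\<^sub>2 \<longleftrightarrow> (\<exists>v\<in>verts P\<^sub>1. \<exists>w\<in>verts P\<^sub>2. v \<rightarrow>\<^sup>*\<^bsub>E\<^esub> w)"

definition downward_directed :: "'p set \<Rightarrow> ('p \<Rightarrow> 'p \<Rightarrow> bool) \<Rightarrow> bool" where
  "downward_directed P ge \<longleftrightarrow>
     partial_order_on P {(x, y). x \<in> P \<and> y \<in> P \<and> ge y x} \<and>
     (\<forall>x\<in>P. \<forall>y\<in>P. \<exists>z\<in>P. ge x z \<and> ge y z)"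


section \<open>Hopf graphs\<close>

definition conjugacy_classes :: "('a, 'm) monoid_scheme \<Rightarrow> 'a set set" where
  "conjugacy_classes G =
     {{g \<otimes>\<^bsub>G\<^esub> x \<otimes>\<^bsub>G\<^esub> inv\<^bsub>G\<^esub> g |g. g \<in> carrier G} |x. x \<in> carrier G}"

text \<open>
  A ramification data is a function \<open>\<rr> :: 'a set \<Rightarrow> nat\<close>, of which only the values on conjugacy
  classes are ever used.
\<close>

definition ram_supp :: "('a, 'm) monoid_scheme \<Rightarrow> ('a set \<Rightarrow> nat) \<Rightarrow> 'a set set" where
  "ram_supp G \<rr> = {C \<in> conjugacy_classes G. \<rr> C > 0}"

definition ram_zero :: "('a, 'm) monoid_scheme \<Rightarrow> ('a set \<Rightarrow> nat) \<Rightarrow> bool" where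
  "ram_zero G \<rr> \<longleftrightarrow> (\<forall>C \<in> conjugacy_classes G. \<rr> C = 0)"

type_synonym 'a hopf_edge = "'a \<times> 'a set \<times> 'a \<times> nat"

text \<open>The edges from x to xc contributed by c in C are (x, C, c, i) for i < \<open>\<rr> C\<close>.\<close>

definition hopf_graph ::
    "('a, 'm) monoid_scheme \<Rightarrow> ('a set \<Rightarrow> nat) \<Rightarrow> ('a, 'a hopf_edge) pre_digraph" where
  "hopf_graph G \<rr> =
     \<lparr>verts = carrier G,
      arcs = {(x, C, c, i). x \<in> carrier G \<and> C \<in> conjugacy_classes G \<and> c \<in> C \<and> i < \<rr> C},
      tail = (\<lambda>(x, C, c, i). x),
      head = (\<lambda>(x, C, c, i). x \<otimes>\<^bsub>G\<^esub> c)\<rparr>"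

inductive_set semigroup_generated :: "('a, 'm) monoid_scheme \<Rightarrow> 'a set \<Rightarrow> 'a set"
  for G and A where
    base: "a \<in> A \<Longrightarrow> a \<in> semigroup_generated G A"
  | mult: "a \<in> semigroup_generated G A \<Longrightarrow> b \<in> semigroup_generated G A \<Longrightarrow>
             a \<otimes>\<^bsub>G\<^esub> b \<in> semigroup_generated G A"

definition hopf_semigroup :: "('a, 'm) monoid_scheme \<Rightarrow> ('a set \<Rightarrow> nat) \<Rightarrow> 'a set" where
  "hopf_semigroup G \<rr> = semigroup_generated G (\<Union> (ram_supp G \<rr>))"

definition trivial_subgraph ::
    "('a, 'm) monoid_scheme \<Rightarrow> ('a set \<Rightarrow> nat) \<Rightarrow> ('a, 'a hopf_edge) pre_digraph" where
  "trivial_subgraph G \<rr> =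
     \<lparr>verts = {\<one>\<^bsub>G\<^esub>}, arcs = {},
      tail = tail (hopf_graph G \<rr>), head = head (hopf_graph G \<rr>)\<rparr>"

definition Delta ::
    "('a, 'm) monoid_scheme \<Rightarrow> ('a set \<Rightarrow> nat) \<Rightarrow> ('a, 'a hopf_edge) pre_digraph" where
  "Delta G \<rr> =
     (if ram_zero G \<rr> then trivial_subgraph G \<rr>
      else let \<Gamma> = hopf_graph G \<rr>; V = generate G (hopf_semigroup G \<rr>)
           in \<lparr>verts = V, arcs = {e \<in> arcs \<Gamma>. head \<Gamma> e \<in> V},
               tail = tail \<Gamma>, head = head \<Gamma>\<rparr>)"

definition largest_subgroup_in :: "('a, 'm) monoid_scheme \<Rightarrow> 'a set \<Rightarrow> 'a set" where
  "largest_subgroup_in G S = (GREATEST H. subgroup H G \<and> H \<subseteq> S)"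

text \<open>For a submonoid S the largest subgroup in S does exist:\<close>

lemma (in group) largest_subgroup_in_submonoid:
  assumes S: "submonoid S G"
  shows "subgroup (largest_subgroup_in G S) G" "largest_subgroup_in G S \<subseteq> S"
    and "\<And>H. subgroup H G \<Longrightarrow> H \<subseteq> S \<Longrightarrow> H \<subseteq> largest_subgroup_in G S"
proof -
  let ?U = "{x \<in> S. inv x \<in> S}"
  interpret S: submonoid S G by (fact S)
  have U: "subgroup ?U G"
  proof (rule subgroupI)
    show "?U \<subseteq> carrier G" using S.subset by blast
    have "inv \<one> \<in> S" using S.one_closed by simp
    then show "?U \<noteq> {}" using S.one_closed by blast
  next
    fix a assume a: "a \<in> ?U"
    then have "inv (inv a) = a" using S.subset by (intro inv_inv) blast
    with a show "inv a \<in> ?U" by simp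
  next
    fix a b assume a: "a \<in> ?U" and b: "b \<in> ?U"
    then have "inv (a \<otimes> b) = inv b \<otimes> inv a" using S.subset by (intro inv_mult_group) blast+
    moreover have "a \<otimes> b \<in> S" "inv b \<otimes> inv a \<in> S" using a b by (blast intro: S.m_closed)+
    ultimately show "a \<otimes> b \<in> ?U" by simp
  qed
  have max: "H \<subseteq> ?U" if "subgroup H G" "H \<subseteq> S" for H
    using that subgroup.m_inv_closed[of H G] by blast
  have eq: "largest_subgroup_in G S = ?U"
    unfolding largest_subgroup_in_def by (rule Greatest_equality) (use U max in blast)+
  show "subgroup (largest_subgroup_in G S) G" "largest_subgroup_in G S \<subseteq> S"
    "\<And>H. subgroup H G \<Longrightarrow> H \<subseteq> S \<Longrightarrow> H \<subseteq> largest_subgroup_in G S"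
    unfolding eq using U max by blast+
qed

definition Lambda ::
    "('a, 'm) monoid_scheme \<Rightarrow> ('a set \<Rightarrow> nat) \<Rightarrow> ('a, 'a hopf_edge) pre_digraph" where
  "Lambda G \<rr> =
     (if \<not> submonoid (hopf_semigroup G \<rr>) G then trivial_subgraph G \<rr>
      else let \<Gamma> = hopf_graph G \<rr>; V = largest_subgroup_in G (hopf_semigroup G \<rr>)
           in \<lparr>verts = V, arcs = {e \<in> arcs \<Gamma>. head \<Gamma> e \<in> V \<and> tail \<Gamma> e \<in> V},
               tail = tail \<Gamma>, head = head \<Gamma>\<rparr>)"


section \<open>Nonunital algebras over a field\<close>

text \<open>
  A not necessarily unital algebra over the field \<^typ>\<open>'k\<close> is represented by its \<^typ>\<open>('k, 'b) module\<close>
  record. The field \<^const>\<open>one\<close> of that record has no meaning here; it is \<^const>\<open>undefined\<close> and is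
  never used.
\<close>

instantiation list :: (type) monoid_add
begin
definition zero_list_def: "0 = ([] :: 'a list)"
definition plus_list_def: "xs + ys = (xs @ ys :: 'a list)"
instance by standard (simp_all add: zero_list_def plus_list_def)
end

text \<open>
  With concatenation as the addition of exponents, \<open>'x list \<Rightarrow>\<^sub>0 'k\<close> is the free unital algebra on
  \<^typ>\<open>'x\<close>, a word being a monomial. The free nonunital algebra on X consists of the combinations of
  the nonempty words with letters in X.
\<close>

definition free_algebra :: "'x set \<Rightarrow> ('k::field, 'x list \<Rightarrow>\<^sub>0 'k) module" where
  "free_algebra X =
     \<lparr>carrier = {f. Poly_Mapping.keys f \<subseteq> lists X - {[]}},
      monoid.mult = (*), one = undefined, zero = 0, add = (+),
      smult = (\<lambda>c f. Poly_Mapping.single [] c * f)\<rparr>"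

inductive_set algebra_ideal_generated :: "('k::field, 'b) module \<Rightarrow> 'b set \<Rightarrow> 'b set"
  for A and R where
    zero: "\<zero>\<^bsub>A\<^esub> \<in> algebra_ideal_generated A R"
  | base: "x \<in> R \<Longrightarrow> x \<in> algebra_ideal_generated A R"
  | add: "x \<in> algebra_ideal_generated A R \<Longrightarrow> y \<in> algebra_ideal_generated A R \<Longrightarrow>
            x \<oplus>\<^bsub>A\<^esub> y \<in> algebra_ideal_generated A R"
  | smult: "x \<in> algebra_ideal_generated A R \<Longrightarrow> c \<odot>\<^bsub>A\<^esub> x \<in> algebra_ideal_generated A R"
  | mult_left: "x \<in> algebra_ideal_generated A R \<Longrightarrow> a \<in> carrier A \<Longrightarrow>
            a \<otimes>\<^bsub>A\<^esub> x \<in> algebra_ideal_generated A R"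
  | mult_right: "x \<in> algebra_ideal_generated A R \<Longrightarrow> a \<in> carrier A \<Longrightarrow>
            x \<otimes>\<^bsub>A\<^esub> a \<in> algebra_ideal_generated A R"

definition quotient_algebra :: "('k::field, 'b) module \<Rightarrow> 'b set \<Rightarrow> ('k, 'b set) module" where
  "quotient_algebra A I =
     \<lparr>carrier = a_rcosets\<^bsub>A\<^esub> I,
      monoid.mult = rcoset_mult A I, one = undefined, zero = I, add = set_add A,
      smult = (\<lambda>c X. \<Union>x\<in>X. I +>\<^bsub>A\<^esub> (c \<odot>\<^bsub>A\<^esub> x))\<rparr>"

definition algebra_direct_sum :: "'i set \<Rightarrow> ('k::field, 'b) module \<Rightarrow> ('k, 'i \<Rightarrow> 'b) module" where
  "algebra_direct_sum X A =
     \<lparr>carrier = {f \<in> X \<rightarrow>\<^sub>E carrier A. finite {x \<in> X. f x \<noteq> \<zero>\<^bsub>A\<^esub>}},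
      monoid.mult = (\<lambda>f g. \<lambda>x\<in>X. f x \<otimes>\<^bsub>A\<^esub> g x), one = undefined,
      zero = (\<lambda>x\<in>X. \<zero>\<^bsub>A\<^esub>), add = (\<lambda>f g. \<lambda>x\<in>X. f x \<oplus>\<^bsub>A\<^esub> g x),
      smult = (\<lambda>c f. \<lambda>x\<in>X. c \<odot>\<^bsub>A\<^esub> f x)\<rparr>"

definition algebra_isomorphic :: "('k::field, 'b) module \<Rightarrow> ('k, 'c) module \<Rightarrow> bool" where
  "algebra_isomorphic A B \<longleftrightarrow>
     (\<exists>h. bij_betw h (carrier A) (carrier B) \<and>
        (\<forall>x\<in>carrier A. \<forall>y\<in>carrier A. h (x \<oplus>\<^bsub>A\<^esub> y) = h x \<oplus>\<^bsub>B\<^esub> h y) \<and>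
        (\<forall>x\<in>carrier A. \<forall>y\<in>carrier A. h (x \<otimes>\<^bsub>A\<^esub> y) = h x \<otimes>\<^bsub>B\<^esub> h y) \<and>
        (\<forall>c. \<forall>x\<in>carrier A. h (c \<odot>\<^bsub>A\<^esub> x) = c \<odot>\<^bsub>B\<^esub> h x))"


section \<open>Leavitt path algebras\<close>

datatype ('v, 'e) lpa_generator = Vertex 'v | Edge 'e | Ghost 'e

definition lpa_generators :: "('v, 'e) pre_digraph \<Rightarrow> ('v, 'e) lpa_generator set" where
  "lpa_generators E = Vertex ` verts E \<union> Edge ` arcs E \<union> Ghost ` arcs E"

abbreviation lpa_vertex :: "'v \<Rightarrow> ('v, 'e) lpa_generator list \<Rightarrow>\<^sub>0 'k::field" where
  "lpa_vertex v \<equiv> Poly_Mapping.single [Vertex v] 1"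

abbreviation lpa_edge :: "'e \<Rightarrow> ('v, 'e) lpa_generator list \<Rightarrow>\<^sub>0 'k::field" where
  "lpa_edge e \<equiv> Poly_Mapping.single [Edge e] 1"

abbreviation lpa_ghost :: "'e \<Rightarrow> ('v, 'e) lpa_generator list \<Rightarrow>\<^sub>0 'k::field" where
  "lpa_ghost e \<equiv> Poly_Mapping.single [Ghost e] 1"

text \<open>The elements that the relations of the Leavitt path algebra send to 0.\<close>

definition lpa_relators ::
    "('v, 'e) pre_digraph \<Rightarrow> (('v, 'e) lpa_generator list \<Rightarrow>\<^sub>0 'k::field) set" where
  "lpa_relators E =
     {lpa_vertex v * lpa_vertex w - (if v = w then lpa_vertex w else 0)
        |v w. v \<in> verts E \<and> w \<in> verts E} \<union>
     {lpa_vertex (tail E e) * lpa_edge e - lpa_edge e |e. e \<in> arcs E} \<union>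
     {lpa_edge e * lpa_vertex (head E e) - lpa_edge e |e. e \<in> arcs E} \<union>
     {lpa_vertex (head E e) * lpa_ghost e - lpa_ghost e |e. e \<in> arcs E} \<union>
     {lpa_ghost e * lpa_vertex (tail E e) - lpa_ghost e |e. e \<in> arcs E} \<union>
     {lpa_ghost e * lpa_edge f - (if e = f then lpa_vertex (head E e) else 0)
        |e f. e \<in> arcs E \<and> f \<in> arcs E} \<union>
     {lpa_vertex v - (\<Sum>e\<in>out_arcs E v. lpa_edge e * lpa_ghost e)
        |v. v \<in> verts E \<and> out_arcs E v \<noteq> {} \<and> finite (out_arcs E v)}"

text \<open>The first argument only fixes the coefficient field.\<close>

definition leavitt_path_algebra ::
    "'k::field itself \<Rightarrow> ('v, 'e) pre_digraph \<Rightarrow>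
       ('k, (('v, 'e) lpa_generator list \<Rightarrow>\<^sub>0 'k) set) module" where
  "leavitt_path_algebra K E =
     (let F = free_algebra (lpa_generators E)
      in quotient_algebra F (algebra_ideal_generated F (lpa_relators E)))"

end

theory Submission
  imports Defs
begin

text \<open>
  Let M be the semigroup S with 1 added, V the subgroup generated by S and U the group of units of M.
  Both V and U are normal. In \<open>\<Gamma>\<close> the vertex y is reachable from x exactly if \<open>x\<inverse>y\<close>
  lies in M, so the connected components of \<open>\<Gamma>\<close> are the cosets of V and its strongly connected
  components are the cosets of U; left translations are automorphisms of \<open>\<Gamma>\<close> and permute them. The
  graphs \<open>\<Delta>\<close> and \<open>\<Lambda>\<close> are the full subgraphs on V and U even in the degenerate cases of their
  definitions, because V and U are then trivial and the identity carries no loop.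

  Let a graph E be a disjoint union of copies of D. A word in the generators of L(E) whose letters
  lie in different copies vanishes in L(E): two adjacent letters from different copies are separated
  by a product of two distinct vertices. Killing the letters outside the i-th copy and identifying
  this copy with D yields the i-th coordinate of a homomorphism from L(E) to the direct sum, and
  modulo the relations every element is the sum of the images of its coordinates.
\<close>

section \<open>Free algebras and their quotients\<close>

text \<open>A polynomial is the finite sum of its monomials, so additive statements need only be
  checked on monomials. The set \<open>W\<close> carries along a restriction on the words that
  occur.\<close>

lemma poly_mapping_monomial_induct:
  assumes keys: "Poly_Mapping.keys f \<subseteq> W"
    and zero: "P 0"
    and single: "\<And>w c. w \<in> W \<Longrightarrow> P (Poly_Mapping.single w c)"
    and add: "\<And>f g. P f \<Longrightarrow> P g \<Longrightarrow> P (f + g)"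
  shows "P (f :: 'a \<Rightarrow>\<^sub>0 'b::comm_monoid_add)"
proof -
  have "P (\<Sum>w\<in>B. Poly_Mapping.single w (Poly_Mapping.lookup f w))"
    if "finite B" "B \<subseteq> W" for B
    using that by (induction rule: finite_induct) (auto intro: zero single add)
  moreover have "f = (\<Sum>w\<in>Poly_Mapping.keys f. Poly_Mapping.single w (Poly_Mapping.lookup f w))"
    by (rule poly_mapping_eqI)
      (simp add: lookup_sum lookup_single when_def in_keys_iff)
  ultimately show ?thesis
    using keys by (metis finite_keys)
qed

section \<open>Homomorphisms between free algebras\<close>

lemma scalar_commute:
  "Poly_Mapping.single [] c * f = f * Poly_Mapping.single [] (c :: 'k::field)"
  by (rule poly_mapping_monomial_induct[of f UNIV])
    (simp_all add: mult_single plus_list_def mult.commute distrib_left distrib_right)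

text \<open>This is the universal property of the free unital algebra: the homomorphism that extends
  the assignment \<open>g\<close> of the letters, scalars being multiples of the empty word.\<close>

definition free_lift ::
    "('x \<Rightarrow> ('y list \<Rightarrow>\<^sub>0 'k::field)) \<Rightarrow> ('x list \<Rightarrow>\<^sub>0 'k) \<Rightarrow> ('y list \<Rightarrow>\<^sub>0 'k)" where
  "free_lift g f =
     (\<Sum>w\<in>Poly_Mapping.keys f. Poly_Mapping.single [] (Poly_Mapping.lookup f w) * prod_list (map g w))"

lemma free_lift_zero [simp]: "free_lift g 0 = 0"
  by (simp add: free_lift_def)

lemma free_lift_single:
  "free_lift g (Poly_Mapping.single w c) = Poly_Mapping.single [] c * prod_list (map g w)"
  by (simp add: free_lift_def)

lemma free_lift_add: "free_lift g (f + h) = free_lift g f + free_lift g h"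
  unfolding free_lift_def
  by (rule setsum_keys_plus_distrib) (simp_all add: single_add distrib_right)

lemma free_lift_uminus: "free_lift g (- f) = - free_lift g f"
  using free_lift_add[of g f "- f"] by (simp add: eq_neg_iff_add_eq_0 add.commute)

lemma free_lift_diff: "free_lift g (f - h) = free_lift g f - free_lift g h"
  using free_lift_add[of g f "- h"] by (simp add: free_lift_uminus)

lemma free_lift_sum: "free_lift g (\<Sum>i\<in>A. f i) = (\<Sum>i\<in>A. free_lift g (f i))"
  by (induction A rule: infinite_finite_induct) (simp_all add: free_lift_add)

text \<open>Both sides are additive in each argument, which leaves two monomials. There the scalar
  of the second has to move past the image of the first word, and scalars are central.\<close>

lemma free_lift_mult: "free_lift g (f * h) = free_lift g f * free_lift g h"
proof (rule poly_mapping_monomial_induct[of f UNIV])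
  fix u c
  show "free_lift g (Poly_Mapping.single u c * h) = free_lift g (Poly_Mapping.single u c) * free_lift g h"
  proof (rule poly_mapping_monomial_induct[of h UNIV])
    fix w d
    have "Poly_Mapping.single [] (c * d) * (prod_list (map g u) * prod_list (map g w)) =
        Poly_Mapping.single [] c * (Poly_Mapping.single [] d * prod_list (map g u)) * prod_list (map g w)"
      by (simp add: mult_single plus_list_def flip: mult.assoc)
    then show "free_lift g (Poly_Mapping.single u c * Poly_Mapping.single w d) =
        free_lift g (Poly_Mapping.single u c) * free_lift g (Poly_Mapping.single w d)"
      unfolding scalar_commute[of d] by (simp add: mult_single free_lift_single plus_list_def mult.assoc)
  qed (simp_all add: distrib_left free_lift_add)
qed (simp_all add: distrib_right free_lift_add)

lemma free_lift_smult:
  "free_lift g (Poly_Mapping.single [] c * f) = Poly_Mapping.single [] c * free_lift g f"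
  by (simp add: free_lift_mult free_lift_single)

text \<open>One letter sent to 0 annihilates the whole product. This is how a coordinate map
  discards the words that leave its copy of the graph.\<close>

lemma free_lift_eq_0:
  assumes "Poly_Mapping.keys f \<subseteq> W" "\<And>w. w \<in> W \<Longrightarrow> \<exists>x\<in>set w. g x = 0"
  shows "free_lift g f = 0"
  using assms(1)
proof (rule poly_mapping_monomial_induct)
  fix w c assume "w \<in> W"
  then have "0 \<in> set (map g w)"
    using assms(2)[of w] by force
  then have "prod_list (map g w) = 0"
    by (metis mult_zero_left mult_zero_right prod_list.Cons prod_list.append split_list)
  then show "free_lift g (Poly_Mapping.single w c) = 0"
    by (simp add: free_lift_single)
qed (simp_all add: free_lift_add)

text \<open>Only the letters that occur matter. On words inside one copy this replaces the case
  distinction in a coordinate map by a plain renaming.\<close>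

lemma free_lift_eqI:
  assumes "Poly_Mapping.keys f \<subseteq> lists Y" "\<And>x. x \<in> Y \<Longrightarrow> g x = h x"
  shows "free_lift g f = free_lift h f"
  using assms(1)
proof (rule poly_mapping_monomial_induct)
  fix w c assume "w \<in> lists Y"
  then have "map g w = map h w"
    using assms(2) by (intro map_cong) auto
  then show "free_lift g (Poly_Mapping.single w c) = free_lift h (Poly_Mapping.single w c)"
    by (simp only: free_lift_single)
qed (simp_all add: free_lift_add)

lemma prod_list_letters:
  "prod_list (map (\<lambda>x. Poly_Mapping.single [\<psi> x] 1) w) = Poly_Mapping.single (map \<psi> w) (1 :: 'k::field)"
  by (induction w)
    (simp_all add: mult_single plus_list_def zero_list_def flip: single_one)

lemma free_lift_rename:
  "free_lift (\<lambda>x. Poly_Mapping.single [\<psi> x] 1) (Poly_Mapping.single w c) =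
     Poly_Mapping.single (map \<psi> w) c"
  by (simp add: free_lift_single prod_list_letters mult_single plus_list_def)

section \<open>The nonunital free algebra\<close>

definition free_carrier :: "'x set \<Rightarrow> ('x list \<Rightarrow>\<^sub>0 'k::field) set" where
  "free_carrier X = {f. Poly_Mapping.keys f \<subseteq> lists X - {[]}}"

lemma free_algebra_simps [simp]:
  "carrier (free_algebra X) = free_carrier X"
  "monoid.mult (free_algebra X) = (*)" "zero (free_algebra X) = 0" "add (free_algebra X) = (+)"
  "smult (free_algebra X) = (\<lambda>c f. Poly_Mapping.single [] c * f)"
  by (simp_all add: free_algebra_def free_carrier_def)

lemma free_carrier_zero: "0 \<in> free_carrier X"
  by (simp add: free_carrier_def)

lemma free_carrier_single:
  "set w \<subseteq> X \<Longrightarrow> w \<noteq> [] \<Longrightarrow> Poly_Mapping.single w c \<in> free_carrier X"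
  by (auto simp: free_carrier_def)

lemma free_carrier_add: "f \<in> free_carrier X \<Longrightarrow> h \<in> free_carrier X \<Longrightarrow> f + h \<in> free_carrier X"
  using keys_add[of f h] by (auto simp: free_carrier_def)

lemma free_carrier_uminus: "f \<in> free_carrier X \<Longrightarrow> - f \<in> free_carrier X"
  by (auto simp: free_carrier_def in_keys_iff)

lemma free_carrier_diff: "f \<in> free_carrier X \<Longrightarrow> h \<in> free_carrier X \<Longrightarrow> f - h \<in> free_carrier X"
  using free_carrier_add[OF _ free_carrier_uminus] by (metis diff_conv_add_uminus)

lemma free_carrier_mult: "f \<in> free_carrier X \<Longrightarrow> h \<in> free_carrier X \<Longrightarrow> f * h \<in> free_carrier X"
  using keys_mult[of f h] unfolding free_carrier_def plus_list_def by fastforce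

lemma free_carrier_smult: "f \<in> free_carrier X \<Longrightarrow> Poly_Mapping.single [] c * f \<in> free_carrier X"
  using keys_mult[of "Poly_Mapping.single [] c" f] by (auto simp: free_carrier_def plus_list_def split: if_splits)

lemma free_carrier_sum:
  "(\<And>i. i \<in> A \<Longrightarrow> f i \<in> free_carrier X) \<Longrightarrow> (\<Sum>i\<in>A. f i) \<in> free_carrier X"
  by (induction A rule: infinite_finite_induct) (simp_all add: free_carrier_add free_carrier_zero)

lemma free_lift_in_free_carrier:
  assumes g: "\<And>x. x \<in> X \<Longrightarrow> g x \<in> free_carrier Y" and f: "f \<in> free_carrier X"
  shows "free_lift g f \<in> free_carrier Y"
proof (rule poly_mapping_monomial_induct[of f "lists X - {[]}"])
  \<comment> \<open>The induction starts at one letter: the empty product is 1, which has a constant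
    term and lies outside the carrier.\<close>
  have "prod_list (map g w) \<in> free_carrier Y" if "w \<noteq> []" "set w \<subseteq> X" for w
    using that
  proof (induction w rule: list_nonempty_induct)
    case (single x)
    then show ?case using g by simp
  next
    case (cons x xs)
    then have "g x * prod_list (map g xs) \<in> free_carrier Y"
      by (intro free_carrier_mult g) auto
    then show ?case by simp
  qed
  then show "free_lift g (Poly_Mapping.single w c) \<in> free_carrier Y" if "w \<in> lists X - {[]}" for w c
    unfolding free_lift_single by (intro free_carrier_smult) (use that in auto)
qed (use f in \<open>auto simp: free_carrier_def[of X] free_lift_add free_carrier_add free_carrier_zero\<close>)

section \<open>Quotients of free algebras by generated ideals\<close>

locale algebra_presentation =
  fixes X :: "'x set" and R :: "('x list \<Rightarrow>\<^sub>0 'k::field) set"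
  assumes relators_closed: "R \<subseteq> free_carrier X"
begin

definition I :: "('x list \<Rightarrow>\<^sub>0 'k) set" where
  "I = algebra_ideal_generated (free_algebra X) R"

definition cls :: "('x list \<Rightarrow>\<^sub>0 'k) \<Rightarrow> ('x list \<Rightarrow>\<^sub>0 'k) set" where
  "cls x = a_r_coset (free_algebra X) I x"

abbreviation quot :: "('k, ('x list \<Rightarrow>\<^sub>0 'k) set) module" where
  "quot \<equiv> quotient_algebra (free_algebra X) (algebra_ideal_generated (free_algebra X) R)"

lemma I_zero: "0 \<in> I"
  and I_base: "x \<in> R \<Longrightarrow> x \<in> I"
  and I_add: "x \<in> I \<Longrightarrow> y \<in> I \<Longrightarrow> x + y \<in> I"
  and I_smult: "x \<in> I \<Longrightarrow> Poly_Mapping.single [] c * x \<in> I"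
  and I_mult_left: "x \<in> I \<Longrightarrow> a \<in> free_carrier X \<Longrightarrow> a * x \<in> I"
  and I_mult_right: "x \<in> I \<Longrightarrow> a \<in> free_carrier X \<Longrightarrow> x * a \<in> I"
  unfolding I_def using algebra_ideal_generated.intros[where A = "free_algebra X" and R = R] by auto

lemma I_induct [consumes 1, case_names zero base add smult mult_left mult_right]:
  assumes "x \<in> I" and "P 0" and "\<And>x. x \<in> R \<Longrightarrow> P x"
    and "\<And>x y. x \<in> I \<Longrightarrow> P x \<Longrightarrow> y \<in> I \<Longrightarrow> P y \<Longrightarrow> P (x + y)"
    and "\<And>x c. x \<in> I \<Longrightarrow> P x \<Longrightarrow> P (Poly_Mapping.single [] c * x)"
    and "\<And>x a. x \<in> I \<Longrightarrow> P x \<Longrightarrow> a \<in> free_carrier X \<Longrightarrow> P (a * x)"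
    and "\<And>x a. x \<in> I \<Longrightarrow> P x \<Longrightarrow> a \<in> free_carrier X \<Longrightarrow> P (x * a)"
  shows "P x"
  using assms(1) unfolding I_def
  by (induction rule: algebra_ideal_generated.induct) (use assms(2-) in \<open>auto simp: I_def\<close>)

text \<open>The rules generating the ideal have no clause for negatives; scaling by -1 supplies
  them.\<close>

lemma I_uminus: "x \<in> I \<Longrightarrow> - x \<in> I"
  using I_smult[of x "-1"]
  by (simp add: single_uminus flip: zero_list_def)

lemma I_diff: "x \<in> I \<Longrightarrow> y \<in> I \<Longrightarrow> x - y \<in> I"
  using I_add[OF _ I_uminus] by (metis diff_conv_add_uminus)

lemma I_sum: "(\<And>i. i \<in> A \<Longrightarrow> f i \<in> I) \<Longrightarrow> (\<Sum>i\<in>A. f i) \<in> I"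
  by (induction A rule: infinite_finite_induct) (simp_all add: I_add I_zero)

lemma I_subset: "x \<in> I \<Longrightarrow> x \<in> free_carrier X"
  by (induction rule: I_induct)
    (use relators_closed in \<open>auto intro: free_carrier_zero free_carrier_add free_carrier_smult free_carrier_mult\<close>)

lemma cls_iff: "y \<in> cls x \<longleftrightarrow> y - x \<in> I"
  unfolding cls_def a_r_coset_def' by (auto simp: algebra_simps intro: bexI[of _ "y - x"])

lemma cls_eq_iff: "cls x = cls y \<longleftrightarrow> x - y \<in> I"
proof
  assume "cls x = cls y"
  then show "x - y \<in> I"
    using cls_iff[of x x] cls_iff[of x y] I_zero by simp
next
  assume "x - y \<in> I"
  then have "z - x \<in> I \<longleftrightarrow> z - y \<in> I" for z
    using I_add[of "z - x" "x - y"] I_diff[of "z - y" "x - y"] by auto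
  then show "cls x = cls y"
    by (auto simp: cls_iff)
qed

lemma cls_self: "x \<in> cls x"
  by (simp add: cls_iff I_zero)

lemma cls_subset: "x \<in> free_carrier X \<Longrightarrow> y \<in> cls x \<Longrightarrow> y \<in> free_carrier X"
  using free_carrier_add[OF I_subset, of "y - x" x] by (simp add: cls_iff)

lemma carrier_quot: "carrier quot = cls ` free_carrier X"
  by (auto simp: quotient_algebra_def A_RCOSETS_def' cls_def I_def)

lemma quot_zero: "\<zero>\<^bsub>quot\<^esub> = cls 0"
  by (auto simp: quotient_algebra_def cls_iff simp flip: I_def)

lemma quot_add: "cls x \<oplus>\<^bsub>quot\<^esub> cls y = cls (x + y)"
proof -
  \<comment> \<open>An element z of the class of x + y splits as (z - y) + y.\<close>
  have "\<exists>h\<in>cls x. \<exists>k\<in>cls y. z = h + k" if "z - (x + y) \<in> I" for z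
    by (rule bexI[of _ "z - y"], rule bexI[of _ y]) (use that cls_self in \<open>auto simp: cls_iff algebra_simps\<close>)
  moreover have "h + k - (x + y) \<in> I" if "h \<in> cls x" "k \<in> cls y" for h k
    using that I_add[of "h - x" "k - y"] by (simp add: cls_iff algebra_simps)
  ultimately show ?thesis
    unfolding quotient_algebra_def set_add_def'
    by (simp flip: I_def cls_def) (auto simp: cls_iff[of _ "x + y"])
qed

text \<open>Independence of the representatives comes from ab - xy = (a - x) b + x (b - y). The
  ideal absorbs only factors from the free carrier, so b and x have to lie there.\<close>

lemma quot_mult:
  assumes "x \<in> free_carrier X" "y \<in> free_carrier X"
  shows "cls x \<otimes>\<^bsub>quot\<^esub> cls y = cls (x * y)"
proof -
  have "cls (a * b) = cls (x * y)" if "a \<in> cls x" "b \<in> cls y" for a b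
  proof -
    have "(a - x) * b + x * (b - y) \<in> I"
      using that assms cls_subset[of y b] by (intro I_add I_mult_left I_mult_right) (auto simp: cls_iff)
    then show ?thesis
      by (simp add: cls_eq_iff algebra_simps)
  qed
  then have "(\<Union>a\<in>cls x. \<Union>b\<in>cls y. cls (a * b)) = cls (x * y)"
    using cls_self by blast
  then show ?thesis
    by (simp add: quotient_algebra_def rcoset_mult_def flip: cls_def I_def)
qed

lemma quot_smult: "c \<odot>\<^bsub>quot\<^esub> cls x = cls (Poly_Mapping.single [] c * x)"
proof -
  have "cls (Poly_Mapping.single [] c * a) = cls (Poly_Mapping.single [] c * x)" if "a \<in> cls x" for a
    using that I_smult[of "a - x" c] by (simp add: cls_eq_iff cls_iff algebra_simps)
  then have "(\<Union>a\<in>cls x. cls (Poly_Mapping.single [] c * a)) = cls (Poly_Mapping.single [] c * x)"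
    using cls_self by blast
  then show ?thesis
    by (simp add: quotient_algebra_def flip: cls_def I_def)
qed

text \<open>This is the first isomorphism theorem. The kernel condition compares two values of
  \<open>\<Phi>\<close>, so that it makes sense for a bare record \<open>B\<close> with no axioms on
  its zero or its addition.\<close>

lemma quot_isomorphic:
  assumes closed: "\<And>x. x \<in> free_carrier X \<Longrightarrow> \<Phi> x \<in> carrier B"
    and surj: "\<And>b. b \<in> carrier B \<Longrightarrow> \<exists>x \<in> free_carrier X. \<Phi> x = b"
    and ker: "\<And>x y. x \<in> free_carrier X \<Longrightarrow> y \<in> free_carrier X \<Longrightarrow> \<Phi> x = \<Phi> y \<longleftrightarrow> x - y \<in> I"
    and add: "\<And>x y. x \<in> free_carrier X \<Longrightarrow> y \<in> free_carrier X \<Longrightarrow> \<Phi> (x + y) = \<Phi> x \<oplus>\<^bsub>B\<^esub> \<Phi> y"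
    and mult: "\<And>x y. x \<in> free_carrier X \<Longrightarrow> y \<in> free_carrier X \<Longrightarrow> \<Phi> (x * y) = \<Phi> x \<otimes>\<^bsub>B\<^esub> \<Phi> y"
    and smult: "\<And>c x. x \<in> free_carrier X \<Longrightarrow> \<Phi> (Poly_Mapping.single [] c * x) = c \<odot>\<^bsub>B\<^esub> \<Phi> x"
  shows "algebra_isomorphic quot B"
proof -
  \<comment> \<open>By \<open>ker\<close>, \<open>\<Phi>\<close> is constant on each coset, so the
    arbitrary choice of a representative does not affect the value.\<close>
  define h where "h = (\<lambda>A. \<Phi> (SOME x. x \<in> A))"
  have h: "h (cls x) = \<Phi> x" if "x \<in> free_carrier X" for x
  proof -
    have "(SOME y. y \<in> cls x) \<in> cls x"
      using cls_self by (rule someI)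
    then show ?thesis
      unfolding h_def using that cls_subset[OF that] by (subst ker) (auto simp: cls_iff)
  qed
  have "inj_on h (cls ` free_carrier X)"
    using h ker by (intro inj_onI) (force simp: cls_eq_iff)
  moreover have "h ` cls ` free_carrier X = carrier B"
  proof -
    have "h ` cls ` free_carrier X = \<Phi> ` free_carrier X"
      unfolding image_image by (intro image_cong refl h)
    also have "\<dots> = carrier B"
      using closed surj by blast
    finally show ?thesis .
  qed
  ultimately have "bij_betw h (carrier quot) (carrier B)"
    by (simp add: carrier_quot bij_betw_def)
  moreover have "h (cls x \<oplus>\<^bsub>quot\<^esub> cls y) = h (cls x) \<oplus>\<^bsub>B\<^esub> h (cls y)"
      "h (cls x \<otimes>\<^bsub>quot\<^esub> cls y) = h (cls x) \<otimes>\<^bsub>B\<^esub> h (cls y)"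
      "h (c \<odot>\<^bsub>quot\<^esub> cls x) = c \<odot>\<^bsub>B\<^esub> h (cls x)"
    if "x \<in> free_carrier X" "y \<in> free_carrier X" for x y c
    using that free_carrier_add[OF that] free_carrier_mult[OF that] free_carrier_smult[OF that(1)]
    by (simp_all only: quot_add quot_mult quot_smult h add mult smult)
  ultimately show ?thesis
    unfolding algebra_isomorphic_def by (intro exI[of _ h]) (auto simp: carrier_quot)
qed

end

text \<open>The preimage of the second ideal is closed under every operation that builds the first
  one from its relators, so only the relators have to be checked.\<close>

lemma free_lift_ideal:
  assumes "algebra_presentation X R" "algebra_presentation Y S"
    and g: "\<And>x. x \<in> X \<Longrightarrow> g x \<in> free_carrier Y"
    and R: "\<And>r. r \<in> R \<Longrightarrow> free_lift g r \<in> algebra_presentation.I Y S"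
    and f: "f \<in> algebra_presentation.I X R"
  shows "free_lift g f \<in> algebra_presentation.I Y S"
proof -
  interpret A: algebra_presentation X R by fact
  interpret B: algebra_presentation Y S by fact
  show ?thesis
    using f
    by (induction rule: A.I_induct)
      (simp_all add: B.I_zero R free_lift_add free_lift_mult free_lift_single B.I_add B.I_smult
        B.I_mult_left[OF _ free_lift_in_free_carrier[OF g]]
        B.I_mult_right[OF _ free_lift_in_free_carrier[OF g]])
qed

section \<open>Leavitt path algebras of disjoint unions\<close>

lemma lpa_relators_cases [consumes 1]:
  fixes r :: "('v, 'e) lpa_generator list \<Rightarrow>\<^sub>0 'k::field"
  assumes "r \<in> lpa_relators E"
  obtains
    (vertices) v w where "v \<in> verts E" "w \<in> verts E"
      "r = lpa_vertex v * lpa_vertex w - (if v = w then lpa_vertex w else 0)"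
  | (tail_edge) e where "e \<in> arcs E" "r = lpa_vertex (tail E e) * lpa_edge e - lpa_edge e"
  | (edge_head) e where "e \<in> arcs E" "r = lpa_edge e * lpa_vertex (head E e) - lpa_edge e"
  | (head_ghost) e where "e \<in> arcs E" "r = lpa_vertex (head E e) * lpa_ghost e - lpa_ghost e"
  | (ghost_tail) e where "e \<in> arcs E" "r = lpa_ghost e * lpa_vertex (tail E e) - lpa_ghost e"
  | (ghost_edge) e f where "e \<in> arcs E" "f \<in> arcs E"
      "r = lpa_ghost e * lpa_edge f - (if e = f then lpa_vertex (head E e) else 0)"
  | (sum_edges) v where "v \<in> verts E" "out_arcs E v \<noteq> {}" "finite (out_arcs E v)"
      "r = lpa_vertex v - (\<Sum>e\<in>out_arcs E v. lpa_edge e * lpa_ghost e)"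
  using assms unfolding lpa_relators_def by blast

lemma lpa_relators_intros:
  "v \<in> verts E \<Longrightarrow> w \<in> verts E \<Longrightarrow>
     lpa_vertex v * lpa_vertex w - (if v = w then lpa_vertex w else 0) \<in> lpa_relators E"
  "e \<in> arcs E \<Longrightarrow> lpa_vertex (tail E e) * lpa_edge e - lpa_edge e \<in> lpa_relators E"
  "e \<in> arcs E \<Longrightarrow> lpa_edge e * lpa_vertex (head E e) - lpa_edge e \<in> lpa_relators E"
  "e \<in> arcs E \<Longrightarrow> lpa_vertex (head E e) * lpa_ghost e - lpa_ghost e \<in> lpa_relators E"
  "e \<in> arcs E \<Longrightarrow> lpa_ghost e * lpa_vertex (tail E e) - lpa_ghost e \<in> lpa_relators E"
  "e \<in> arcs E \<Longrightarrow> f \<in> arcs E \<Longrightarrow>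
     lpa_ghost e * lpa_edge f - (if e = f then lpa_vertex (head E e) else 0) \<in> lpa_relators E"
  "v \<in> verts E \<Longrightarrow> out_arcs E v \<noteq> {} \<Longrightarrow> finite (out_arcs E v) \<Longrightarrow>
     lpa_vertex v - (\<Sum>e\<in>out_arcs E v. lpa_edge e * lpa_ghost e) \<in> lpa_relators E"
  unfolding lpa_relators_def by blast+

lemma lpa_generators_iff [simp]:
  "Vertex v \<in> lpa_generators E \<longleftrightarrow> v \<in> verts E"
  "Edge e \<in> lpa_generators E \<longleftrightarrow> e \<in> arcs E"
  "Ghost e \<in> lpa_generators E \<longleftrightarrow> e \<in> arcs E"
  by (auto simp: lpa_generators_def)

text \<open>Well-formedness puts source and range of an edge among the vertices, so relators mention
  only generators, and all their words have length 1 or 2.\<close>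

lemma lpa_relators_closed:
  assumes "wf_digraph E"
  shows "lpa_relators E \<subseteq> (free_carrier (lpa_generators E) :: (_ \<Rightarrow>\<^sub>0 'k::field) set)"
proof
  interpret wf_digraph E by fact
  fix r :: "_ \<Rightarrow>\<^sub>0 'k" assume "r \<in> lpa_relators E"
  then show "r \<in> free_carrier (lpa_generators E)"
    by (cases rule: lpa_relators_cases)
      (auto intro!: free_carrier_diff free_carrier_mult free_carrier_sum free_carrier_single free_carrier_zero)
qed

lemma single_Nil_1: "Poly_Mapping.single [] 1 = (1 :: 'x list \<Rightarrow>\<^sub>0 'k::field)"
  using single_one[where 'a = "'x list"] by (simp add: zero_list_def)

lemma free_lift_letter: "free_lift g (Poly_Mapping.single [x] 1) = g x"
  by (simp add: free_lift_single single_Nil_1)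

section \<open>Transport of the relations along graph isomorphisms\<close>

lemma map_lpa_generator_iso:
  assumes "pre_digraph.digraph_isomorphism H \<phi>" "x \<in> lpa_generators H"
  shows "map_lpa_generator (iso_verts \<phi>) (iso_arcs \<phi>) x \<in> lpa_generators (app_iso \<phi> H)"
  using assms(2) by (auto simp: lpa_generators_def)

lemma map_lpa_generator_inv_iso:
  assumes "pre_digraph.digraph_isomorphism H \<phi>" "x \<in> lpa_generators H"
  shows "map_lpa_generator (iso_verts (pre_digraph.inv_iso H \<phi>)) (iso_arcs (pre_digraph.inv_iso H \<phi>))
    (map_lpa_generator (iso_verts \<phi>) (iso_arcs \<phi>) x) = x"
  using assms by (auto simp: lpa_generators_def pre_digraph.iso_inv_simps)

lemma map_lpa_generator_iso_inv:
  assumes "pre_digraph.digraph_isomorphism H \<phi>" "x \<in> lpa_generators (app_iso \<phi> H)"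
  shows "map_lpa_generator (iso_verts \<phi>) (iso_arcs \<phi>)
    (map_lpa_generator (iso_verts (pre_digraph.inv_iso H \<phi>)) (iso_arcs (pre_digraph.inv_iso H \<phi>)) x) = x"
  using assms by (auto simp: lpa_generators_def pre_digraph.iso_inv_simps)

lemma lpa_relators_iso:
  fixes r :: "('v, 'e) lpa_generator list \<Rightarrow>\<^sub>0 'k::field"
    and \<phi> :: "('v, 'e, 'w, 'f) digraph_isomorphism"
  assumes \<phi>: "pre_digraph.digraph_isomorphism H \<phi>" and r: "r \<in> lpa_relators H"
  shows "free_lift (\<lambda>x. Poly_Mapping.single [map_lpa_generator (iso_verts \<phi>) (iso_arcs \<phi>) x] 1) r
    \<in> lpa_relators (app_iso \<phi> H)"
proof -
  interpret wf_digraph H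
    using \<phi> by (simp add: pre_digraph.digraph_isomorphism_def)
  note simps = free_lift_diff free_lift_mult free_lift_sum free_lift_letter
  have ends: "iso_verts \<phi> (tail H e) = tail (app_iso \<phi> H) (iso_arcs \<phi> e)"
    "iso_verts \<phi> (head H e) = head (app_iso \<phi> H) (iso_arcs \<phi> e)" if "e \<in> arcs H" for e
    using that \<phi> by (simp_all add: iso_verts_tail iso_verts_head)
  show ?thesis
    using r
  proof (cases rule: lpa_relators_cases)
    case (vertices v w)
    then show ?thesis
      using lpa_relators_intros(1)[of "iso_verts \<phi> v" "app_iso \<phi> H" "iso_verts \<phi> w"] \<phi>
      by (auto simp: simps split: if_splits)
  next
    case (tail_edge e)
    then show ?thesis
      using lpa_relators_intros(2)[of "iso_arcs \<phi> e" "app_iso \<phi> H"]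
      by (simp only: simps ends lpa_generator.map) simp
  next
    case (edge_head e)
    then show ?thesis
      using lpa_relators_intros(3)[of "iso_arcs \<phi> e" "app_iso \<phi> H"]
      by (simp only: simps ends lpa_generator.map) simp
  next
    case (head_ghost e)
    then show ?thesis
      using lpa_relators_intros(4)[of "iso_arcs \<phi> e" "app_iso \<phi> H"]
      by (simp only: simps ends lpa_generator.map) simp
  next
    case (ghost_tail e)
    then show ?thesis
      using lpa_relators_intros(5)[of "iso_arcs \<phi> e" "app_iso \<phi> H"]
      by (simp only: simps ends lpa_generator.map) simp
  next
    case (ghost_edge e f)
    then show ?thesis
      using lpa_relators_intros(6)[of "iso_arcs \<phi> e" "app_iso \<phi> H" "iso_arcs \<phi> f"] \<phi>
        ends(2)[of e]
      by (auto simp: simps split: if_splits)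
  next
    case (sum_edges v)
    \<comment> \<open>The edges leaving v correspond bijectively to those leaving its image, so both
      the finiteness condition and the sum carry over.\<close>
    have out: "out_arcs (app_iso \<phi> H) (iso_verts \<phi> v) = iso_arcs \<phi> ` out_arcs H v"
      using \<phi> sum_edges by (simp add: out_arcs_app_iso_eq)
    moreover have "inj_on (iso_arcs \<phi>) (out_arcs H v)"
      using digraph_isomorphism_inj_on_arcs[OF \<phi>] by (rule inj_on_subset) auto
    ultimately show ?thesis
      using lpa_relators_intros(7)[of "iso_verts \<phi> v" "app_iso \<phi> H"] sum_edges
      by (simp add: simps sum.reindex)
  qed
qed

section \<open>Disjoint unions of copies of one graph\<close>

locale copies_of_graph =
  fixes K :: "'k::field itself"
    and E :: "('v, 'e) pre_digraph" and T :: "'i set" and \<Omega> :: "'i \<Rightarrow> ('v, 'e) pre_digraph"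
    and D :: "('w, 'f) pre_digraph" and h :: "'i \<Rightarrow> ('v, 'e, 'w, 'f) digraph_isomorphism"
  assumes union: "is_disjoint_union E T \<Omega>"
    and iso: "i \<in> T \<Longrightarrow> pre_digraph.digraph_isomorphism (\<Omega> i) (h i)"
    and app_iso: "i \<in> T \<Longrightarrow> app_iso (h i) (\<Omega> i) = D"
    and wf_E: "wf_digraph E" and wf_D: "wf_digraph D"
begin

sublocale E: algebra_presentation
  "lpa_generators E" "lpa_relators E :: (('v, 'e) lpa_generator list \<Rightarrow>\<^sub>0 'k) set"
  by standard (rule lpa_relators_closed[OF wf_E])

sublocale D: algebra_presentation
  "lpa_generators D" "lpa_relators D :: (('w, 'f) lpa_generator list \<Rightarrow>\<^sub>0 'k) set"
  by standard (rule lpa_relators_closed[OF wf_D])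

lemma wf: "i \<in> T \<Longrightarrow> wf_digraph (\<Omega> i)"
  and tail_eq: "i \<in> T \<Longrightarrow> tail (\<Omega> i) = tail E"
  and head_eq: "i \<in> T \<Longrightarrow> head (\<Omega> i) = head E"
  and verts_subset: "i \<in> T \<Longrightarrow> verts (\<Omega> i) \<subseteq> verts E"
  and arcs_subset: "i \<in> T \<Longrightarrow> arcs (\<Omega> i) \<subseteq> arcs E"
  using union by (auto simp: is_disjoint_union_def subgraph_def compatible_def)

lemma verts_E: "verts E = (\<Union>i\<in>T. verts (\<Omega> i))"
  and arcs_E: "arcs E = (\<Union>i\<in>T. arcs (\<Omega> i))"
proof -
  have E: "E = pre_digraph.Union E (\<Omega> ` T)"
    using union unfolding is_disjoint_union_def by blast
  show "verts E = (\<Union>i\<in>T. verts (\<Omega> i))"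
    by (subst E) (simp add: pre_digraph.Union_def)
  show "arcs E = (\<Union>i\<in>T. arcs (\<Omega> i))"
    by (subst E) (simp add: pre_digraph.Union_def)
qed

lemma verts_disjoint:
  "i \<in> T \<Longrightarrow> j \<in> T \<Longrightarrow> v \<in> verts (\<Omega> i) \<Longrightarrow> v \<in> verts (\<Omega> j) \<Longrightarrow> i = j"
  using union by (auto simp: is_disjoint_union_def disjoint_family_on_def)

lemma tail_in: "i \<in> T \<Longrightarrow> e \<in> arcs (\<Omega> i) \<Longrightarrow> tail E e \<in> verts (\<Omega> i)"
  and head_in: "i \<in> T \<Longrightarrow> e \<in> arcs (\<Omega> i) \<Longrightarrow> head E e \<in> verts (\<Omega> i)"
  using wf_digraph.tail_in_verts[OF wf] wf_digraph.head_in_verts[OF wf] tail_eq head_eq by metis+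

lemma arcs_disjoint:
  "i \<in> T \<Longrightarrow> j \<in> T \<Longrightarrow> e \<in> arcs (\<Omega> i) \<Longrightarrow> e \<in> arcs (\<Omega> j) \<Longrightarrow> i = j"
  using verts_disjoint tail_in by metis

lemma generators_E: "lpa_generators E = (\<Union>i\<in>T. lpa_generators (\<Omega> i))"
  unfolding lpa_generators_def verts_E arcs_E by blast

lemma generators_disjoint:
  "i \<in> T \<Longrightarrow> j \<in> T \<Longrightarrow> x \<in> lpa_generators (\<Omega> i) \<Longrightarrow> x \<in> lpa_generators (\<Omega> j) \<Longrightarrow> i = j"
  by (cases x) (auto dest: verts_disjoint arcs_disjoint)

text \<open>An edge leaving v lies in some component, and by disjointness of the vertex sets this is
  the component of v. Hence the summation relation at v is the same in the component as in
  \<open>E\<close>.\<close>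

lemma out_arcs_component:
  assumes "i \<in> T" "v \<in> verts (\<Omega> i)"
  shows "out_arcs (\<Omega> i) v = out_arcs E v"
proof -
  have "e \<in> arcs (\<Omega> i)" if "e \<in> arcs E" "tail E e = v" for e
    using that assms verts_disjoint tail_in unfolding arcs_E by blast
  then show ?thesis
    using assms arcs_subset[OF assms(1)] by (auto simp: tail_eq)
qed

lemma relators_component_subset: "i \<in> T \<Longrightarrow> lpa_relators (\<Omega> i) \<subseteq> lpa_relators E"
proof
  fix r :: "('v, 'e) lpa_generator list \<Rightarrow>\<^sub>0 'k2::field"
  assume i: "i \<in> T" and "r \<in> lpa_relators (\<Omega> i)"
  from this(2) verts_subset[OF i] arcs_subset[OF i] show "r \<in> lpa_relators E"
    by (cases rule: lpa_relators_cases)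
      (auto simp only: tail_eq[OF i] head_eq[OF i] out_arcs_component[OF i] intro!: lpa_relators_intros)
qed

text \<open>A relator built from one vertex or one edge belongs to the component of that vertex or
  edge. A relator pairing two vertices, or a ghost edge with an edge, may straddle two components;
  its Kronecker delta is then 0 and a single word of two letters remains.\<close>

lemma relators_E:
  fixes r :: "('v, 'e) lpa_generator list \<Rightarrow>\<^sub>0 'k"
  assumes "r \<in> lpa_relators E"
  shows "(\<exists>i\<in>T. r \<in> lpa_relators (\<Omega> i)) \<or>
    (\<exists>i\<in>T. \<exists>j\<in>T. i \<noteq> j \<and> (\<exists>x\<in>lpa_generators (\<Omega> i). \<exists>y\<in>lpa_generators (\<Omega> j).
       r = Poly_Mapping.single [x, y] 1))"
  using assms
proof (cases rule: lpa_relators_cases)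
  case (vertices v w)
  then obtain i j where ij: "i \<in> T" "j \<in> T" "v \<in> verts (\<Omega> i)" "w \<in> verts (\<Omega> j)"
    unfolding verts_E by blast
  show ?thesis
  proof (cases "i = j")
    case True
    then show ?thesis
      using ij vertices lpa_relators_intros(1)[of v "\<Omega> i" w] by auto
  next
    case False
    then have "v \<noteq> w"
      using ij verts_disjoint by blast
    then have "r = Poly_Mapping.single [Vertex v, Vertex w] 1"
      using vertices by (simp add: mult_single plus_list_def)
    moreover have "Vertex v \<in> lpa_generators (\<Omega> i)" "Vertex w \<in> lpa_generators (\<Omega> j)"
      using ij by simp_all
    ultimately show ?thesis
      using False ij by blast
  qed
next
  case (tail_edge e)
  then obtain i where "i \<in> T" "e \<in> arcs (\<Omega> i)"
    unfolding arcs_E by blast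
  then show ?thesis
    using tail_edge lpa_relators_intros(2)[of e "\<Omega> i"] by (auto simp: tail_eq)
next
  case (edge_head e)
  then obtain i where "i \<in> T" "e \<in> arcs (\<Omega> i)"
    unfolding arcs_E by blast
  then show ?thesis
    using edge_head lpa_relators_intros(3)[of e "\<Omega> i"] by (auto simp: head_eq)
next
  case (head_ghost e)
  then obtain i where "i \<in> T" "e \<in> arcs (\<Omega> i)"
    unfolding arcs_E by blast
  then show ?thesis
    using head_ghost lpa_relators_intros(4)[of e "\<Omega> i"] by (auto simp: head_eq)
next
  case (ghost_tail e)
  then obtain i where "i \<in> T" "e \<in> arcs (\<Omega> i)"
    unfolding arcs_E by blast
  then show ?thesis
    using ghost_tail lpa_relators_intros(5)[of e "\<Omega> i"] by (auto simp: tail_eq)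
next
  case (ghost_edge e f)
  then obtain i j where ij: "i \<in> T" "j \<in> T" "e \<in> arcs (\<Omega> i)" "f \<in> arcs (\<Omega> j)"
    unfolding arcs_E by blast
  show ?thesis
  proof (cases "i = j")
    case True
    then show ?thesis
      using ij ghost_edge lpa_relators_intros(6)[of e "\<Omega> i" f] by (auto simp: head_eq)
  next
    case False
    then have "e \<noteq> f"
      using ij arcs_disjoint by blast
    then have "r = Poly_Mapping.single [Ghost e, Edge f] 1"
      using ghost_edge by (simp add: mult_single plus_list_def)
    moreover have "Ghost e \<in> lpa_generators (\<Omega> i)" "Edge f \<in> lpa_generators (\<Omega> j)"
      using ij by simp_all
    ultimately show ?thesis
      using False ij by blast
  qed
next
  case (sum_edges v)
  then obtain i where i: "i \<in> T" "v \<in> verts (\<Omega> i)"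
    unfolding verts_E by blast
  then show ?thesis
    using sum_edges lpa_relators_intros(7)[of v "\<Omega> i"] by (auto simp: out_arcs_component)
qed

section \<open>Coordinate maps and their sections\<close>

definition to_D :: "'i \<Rightarrow> ('v, 'e) lpa_generator \<Rightarrow> ('w, 'f) lpa_generator" where
  "to_D i = map_lpa_generator (iso_verts (h i)) (iso_arcs (h i))"

definition from_D :: "'i \<Rightarrow> ('w, 'f) lpa_generator \<Rightarrow> ('v, 'e) lpa_generator" where
  "from_D i = (let g = pre_digraph.inv_iso (\<Omega> i) (h i) in map_lpa_generator (iso_verts g) (iso_arcs g))"

definition proj ::
    "'i \<Rightarrow> (('v, 'e) lpa_generator list \<Rightarrow>\<^sub>0 'k) \<Rightarrow> (('w, 'f) lpa_generator list \<Rightarrow>\<^sub>0 'k)" where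
  "proj i = free_lift (\<lambda>x. if x \<in> lpa_generators (\<Omega> i) then Poly_Mapping.single [to_D i x] 1 else 0)"

definition embed ::
    "'i \<Rightarrow> (('w, 'f) lpa_generator list \<Rightarrow>\<^sub>0 'k) \<Rightarrow> (('v, 'e) lpa_generator list \<Rightarrow>\<^sub>0 'k)" where
  "embed i = free_lift (\<lambda>x. Poly_Mapping.single [from_D i x] 1)"

lemma to_D_in: "i \<in> T \<Longrightarrow> x \<in> lpa_generators (\<Omega> i) \<Longrightarrow> to_D i x \<in> lpa_generators D"
  using map_lpa_generator_iso[OF iso, of i x] by (simp add: to_D_def app_iso)

lemma app_iso_inv: "i \<in> T \<Longrightarrow> app_iso (pre_digraph.inv_iso (\<Omega> i) (h i)) D = \<Omega> i"
  using pre_digraph.app_iso_inv[OF iso, of i] by (simp add: app_iso)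

lemma iso_inv: "i \<in> T \<Longrightarrow> pre_digraph.digraph_isomorphism D (pre_digraph.inv_iso (\<Omega> i) (h i))"
  using wf_digraph.digraph_isomorphism_invI[OF wf iso, of i] by (simp add: app_iso)

lemma from_D_in: "i \<in> T \<Longrightarrow> x \<in> lpa_generators D \<Longrightarrow> from_D i x \<in> lpa_generators (\<Omega> i)"
  using map_lpa_generator_iso[OF iso_inv, of i x] by (simp add: from_D_def app_iso_inv Let_def)

lemma from_D_to_D: "i \<in> T \<Longrightarrow> x \<in> lpa_generators (\<Omega> i) \<Longrightarrow> from_D i (to_D i x) = x"
  using map_lpa_generator_inv_iso[OF iso, of i x] by (simp add: to_D_def from_D_def Let_def)

lemma to_D_from_D: "i \<in> T \<Longrightarrow> x \<in> lpa_generators D \<Longrightarrow> to_D i (from_D i x) = x"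
  using map_lpa_generator_iso_inv[OF iso, of i x] by (simp add: to_D_def from_D_def Let_def app_iso)

lemma proj_closed: "i \<in> T \<Longrightarrow> f \<in> free_carrier (lpa_generators E) \<Longrightarrow> proj i f \<in> free_carrier (lpa_generators D)"
  unfolding proj_def
  by (erule free_lift_in_free_carrier[rotated])
    (auto intro!: free_carrier_single free_carrier_zero to_D_in)

lemma embed_letter_closed:
  "i \<in> T \<Longrightarrow> x \<in> lpa_generators D \<Longrightarrow> Poly_Mapping.single [from_D i x] c \<in> free_carrier (lpa_generators E)"
  using from_D_in by (intro free_carrier_single) (auto simp: generators_E)

lemma embed_closed: "i \<in> T \<Longrightarrow> f \<in> free_carrier (lpa_generators D) \<Longrightarrow> embed i f \<in> free_carrier (lpa_generators E)"
  unfolding embed_def by (rule free_lift_in_free_carrier[OF embed_letter_closed])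

lemma proj_single:
  assumes "i \<in> T" "set w \<subseteq> lpa_generators (\<Omega> i)"
  shows "proj i (Poly_Mapping.single w c) = Poly_Mapping.single (map (to_D i) w) c"
proof -
  have "proj i (Poly_Mapping.single w c) =
      free_lift (\<lambda>x. Poly_Mapping.single [to_D i x] 1) (Poly_Mapping.single w c)"
    unfolding proj_def
    by (rule free_lift_eqI[where Y = "lpa_generators (\<Omega> i)"]) (use assms in auto)
  then show ?thesis
    by (simp add: free_lift_rename)
qed

lemma proj_single_0:
  "\<not> set w \<subseteq> lpa_generators (\<Omega> i) \<Longrightarrow> proj i (Poly_Mapping.single w c) = 0"
  unfolding proj_def by (rule free_lift_eq_0[where W = "{w}"]) auto

lemma embed_single: "embed i (Poly_Mapping.single w c) = Poly_Mapping.single (map (from_D i) w) c"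
  by (simp add: embed_def free_lift_rename)

text \<open>The equation holds in the free algebra itself, not just modulo the relations: for i = j
  the two renamings cancel, and otherwise a nonempty word contains a letter that
  \<open>proj j\<close> kills.\<close>

lemma proj_embed:
  assumes "i \<in> T" "j \<in> T" "f \<in> free_carrier (lpa_generators D)"
  shows "proj j (embed i f) = (if i = j then f else 0)"
proof (rule poly_mapping_monomial_induct[of f "lists (lpa_generators D) - {[]}"])
  fix w c assume w: "w \<in> lists (lpa_generators D) - {[]}"
  have *: "set (map (from_D i) w) \<subseteq> lpa_generators (\<Omega> i)"
    using w from_D_in[OF assms(1)] by auto
  show "proj j (embed i (Poly_Mapping.single w c)) = (if i = j then Poly_Mapping.single w c else 0)"
  proof (cases "i = j")
    case True
    have "map (to_D i) (map (from_D i) w) = w"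
      using w assms(1) by (auto simp: to_D_from_D intro!: map_idI)
    then show ?thesis
      using True assms(1) * by (simp add: embed_single proj_single)
  next
    case False
    then have "\<not> set (map (from_D i) w) \<subseteq> lpa_generators (\<Omega> j)"
      using * w generators_disjoint[OF assms(1,2)] by (cases w) auto
    then show ?thesis
      using False by (simp add: embed_single proj_single_0)
  qed
qed (use assms in \<open>auto simp: free_carrier_def proj_def embed_def free_lift_add\<close>)

text \<open>Renaming backwards along \<open>h i\<close> turns relators of \<open>D\<close> into
  relators of the i-th component, which are relators of \<open>E\<close>.\<close>

lemma embed_ideal: "i \<in> T \<Longrightarrow> f \<in> D.I \<Longrightarrow> embed i f \<in> E.I"
  unfolding embed_def
proof (erule free_lift_ideal[OF D.algebra_presentation_axioms E.algebra_presentation_axioms, rotated 2])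
  fix r :: "('w, 'f) lpa_generator list \<Rightarrow>\<^sub>0 'k"
  assume "i \<in> T" "r \<in> lpa_relators D"
  then have "free_lift (\<lambda>x. Poly_Mapping.single [from_D i x] 1) r \<in> lpa_relators (\<Omega> i)"
    using lpa_relators_iso[OF iso_inv, of i r] by (simp add: app_iso_inv from_D_def Let_def)
  then show "free_lift (\<lambda>x. Poly_Mapping.single [from_D i x] 1) r \<in> E.I"
    using \<open>i \<in> T\<close> relators_component_subset E.I_base by blast
qed (rule embed_letter_closed)

text \<open>By \<open>relators_E\<close> there are three kinds of relators: those of the i-th copy
  become relators of \<open>D\<close>, while those of another copy and the mixed words of two
  letters become 0.\<close>

lemma proj_ideal:
  assumes i: "i \<in> T" and "f \<in> E.I"
  shows "proj i f \<in> D.I"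
  using assms(2) unfolding proj_def
proof (erule_tac free_lift_ideal[OF E.algebra_presentation_axioms D.algebra_presentation_axioms, rotated 2])
  fix r :: "('v, 'e) lpa_generator list \<Rightarrow>\<^sub>0 'k"
  assume r: "r \<in> lpa_relators E"
  have "proj i r \<in> D.I"
  proof (cases "\<exists>j\<in>T. r \<in> lpa_relators (\<Omega> j)")
    case True
    then obtain j where j: "j \<in> T" "r \<in> lpa_relators (\<Omega> j)" by blast
    then have keys: "Poly_Mapping.keys r \<subseteq> lists (lpa_generators (\<Omega> j)) - {[]}"
      using lpa_relators_closed[OF wf, of j] by (auto simp: free_carrier_def)
    show ?thesis
    proof (cases "i = j")
      case True
      have "proj i r = free_lift (\<lambda>x. Poly_Mapping.single [to_D i x] 1) r"
        unfolding proj_def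
        by (rule free_lift_eqI[where Y = "lpa_generators (\<Omega> i)"]) (use keys True in auto)
      also have "\<dots> \<in> lpa_relators D"
        using lpa_relators_iso[OF iso, of i r] j True by (simp add: app_iso to_D_def)
      finally show ?thesis by (rule D.I_base)
    next
      case False
      \<comment> \<open>Every word of r is nonempty, and its head lies in the j-th copy and is
        therefore killed.\<close>
      then have "proj i r = 0"
        unfolding proj_def using generators_disjoint[OF i j(1)]
        by (intro free_lift_eq_0[OF keys] bexI[of _ "hd _"]) (auto dest: hd_in_set)
      then show ?thesis by (simp add: D.I_zero)
    qed
  next
    case False
    then obtain j k x y where *: "j \<in> T" "k \<in> T" "j \<noteq> k" "x \<in> lpa_generators (\<Omega> j)"
      "y \<in> lpa_generators (\<Omega> k)" "r = Poly_Mapping.single [x, y] 1"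
      using relators_E[OF r] by blast
    then have "\<not> set [x, y] \<subseteq> lpa_generators (\<Omega> i)"
      using generators_disjoint[OF i] by auto
    then have "proj i r = 0"
      unfolding *(6) by (rule proj_single_0)
    then show ?thesis by (simp add: D.I_zero)
  qed
  then show "free_lift (\<lambda>x. if x \<in> lpa_generators (\<Omega> i) then Poly_Mapping.single [to_D i x] 1 else 0) r \<in> D.I"
    by (simp add: proj_def)
qed (auto intro!: free_carrier_single free_carrier_zero to_D_in i)

section \<open>Words with letters from several copies\<close>

lemma absorb_right:
  assumes "i \<in> T" "x \<in> lpa_generators (\<Omega> i)"
  shows "\<exists>v\<in>verts (\<Omega> i). Poly_Mapping.single [x] 1 * lpa_vertex v - Poly_Mapping.single [x] 1 \<in> E.I"
proof (cases x)
  case (Vertex v)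
  then have "lpa_vertex v * lpa_vertex v - lpa_vertex v \<in> E.I"
    using lpa_relators_intros(1)[of v E v] assms verts_subset by (intro E.I_base) auto
  then show ?thesis using assms Vertex by auto
next
  case (Edge e)
  then have "lpa_edge e * lpa_vertex (head E e) - lpa_edge e \<in> E.I"
    using lpa_relators_intros(3)[of e E] assms arcs_subset by (intro E.I_base) auto
  then show ?thesis using assms Edge head_in by auto
next
  case (Ghost e)
  then have "lpa_ghost e * lpa_vertex (tail E e) - lpa_ghost e \<in> E.I"
    using lpa_relators_intros(5)[of e E] assms arcs_subset by (intro E.I_base) auto
  then show ?thesis using assms Ghost tail_in by auto
qed

text \<open>The local unit on the left is a vertex itself, the source of an edge or the range of a
  ghost edge; on the right, source and range are exchanged. In every case it belongs to the copy of
  the generator.\<close>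

lemma absorb_left:
  assumes "i \<in> T" "x \<in> lpa_generators (\<Omega> i)"
  shows "\<exists>v\<in>verts (\<Omega> i). lpa_vertex v * Poly_Mapping.single [x] 1 - Poly_Mapping.single [x] 1 \<in> E.I"
proof (cases x)
  case (Vertex v)
  then have "lpa_vertex v * lpa_vertex v - lpa_vertex v \<in> E.I"
    using lpa_relators_intros(1)[of v E v] assms verts_subset by (intro E.I_base) auto
  then show ?thesis using assms Vertex by auto
next
  case (Edge e)
  then have "lpa_vertex (tail E e) * lpa_edge e - lpa_edge e \<in> E.I"
    using lpa_relators_intros(2)[of e E] assms arcs_subset by (intro E.I_base) auto
  then show ?thesis using assms Edge tail_in by auto
next
  case (Ghost e)
  then have "lpa_vertex (head E e) * lpa_ghost e - lpa_ghost e \<in> E.I"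
    using lpa_relators_intros(4)[of e E] assms arcs_subset by (intro E.I_base) auto
  then show ?thesis using assms Ghost head_in by auto
qed

lemma cross_product_in_ideal:
  assumes ij: "i \<in> T" "j \<in> T" "i \<noteq> j"
    and xy: "x \<in> lpa_generators (\<Omega> i)" "y \<in> lpa_generators (\<Omega> j)"
  shows "Poly_Mapping.single [x, y] 1 \<in> E.I"
proof -
  let ?x = "Poly_Mapping.single [x] (1 :: 'k)" and ?y = "Poly_Mapping.single [y] (1 :: 'k)"
  obtain v where v: "v \<in> verts (\<Omega> i)" "?x * lpa_vertex v - ?x \<in> E.I"
    using absorb_right ij xy by blast
  obtain w where w: "w \<in> verts (\<Omega> j)" "lpa_vertex w * ?y - ?y \<in> E.I"
    using absorb_left ij xy by blast
  have "v \<noteq> w"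
    using v w ij verts_disjoint by blast
  then have vw: "lpa_vertex v * lpa_vertex w \<in> E.I"
    using lpa_relators_intros(1)[of v E w] v w ij verts_subset by (intro E.I_base) auto
  have mem: "?x \<in> free_carrier (lpa_generators E)" "?y \<in> free_carrier (lpa_generators E)"
      "lpa_vertex v \<in> free_carrier (lpa_generators E)"
    using v ij xy verts_subset by (auto simp: generators_E intro!: free_carrier_single)
  \<comment> \<open>The right-hand side telescopes to the left-hand side, and each of its three
    terms has a factor in the ideal.\<close>
  have "?x * ?y = ?x * (lpa_vertex v * lpa_vertex w) * ?y - (?x * lpa_vertex v - ?x) * ?y
      - ?x * lpa_vertex v * (lpa_vertex w * ?y - ?y)"
    by (simp add: algebra_simps)
  also have "\<dots> \<in> E.I"
    by (intro E.I_diff E.I_mult_left E.I_mult_right v w vw mem free_carrier_mult)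
  finally show ?thesis
    by (simp add: mult_single plus_list_def)
qed

text \<open>Consider the word without its first letter. If it stays in one copy, the first letter
  comes from another copy and the first two letters already give an element of the ideal. Otherwise
  it is mixed itself and the induction hypothesis applies.\<close>

lemma mixed_word_in_ideal:
  assumes "w \<noteq> []" "set w \<subseteq> lpa_generators E" "\<And>i. i \<in> T \<Longrightarrow> \<not> set w \<subseteq> lpa_generators (\<Omega> i)"
  shows "Poly_Mapping.single w c \<in> E.I"
  using assms
proof (induction w rule: list_nonempty_induct)
  case (single x)
  then show ?case by (auto simp: generators_E)
next
  case (cons x w)
  then obtain i where i: "i \<in> T" "x \<in> lpa_generators (\<Omega> i)"
    by (auto simp: generators_E)
  show ?case
  proof (cases "\<exists>j\<in>T. set w \<subseteq> lpa_generators (\<Omega> j)")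
    case True
    then obtain j y u where j: "j \<in> T" "set w \<subseteq> lpa_generators (\<Omega> j)" "w = y # u"
      using cons.hyps by (cases w) auto
    then have "i \<noteq> j"
      using i cons.prems(2) by fastforce
    then have xy: "Poly_Mapping.single [x, y] 1 \<in> E.I"
      using i j by (intro cross_product_in_ideal) auto
    have "Poly_Mapping.single [x, y] 1 * Poly_Mapping.single u c \<in> E.I"
    \<comment> \<open>For empty u the right factor is a scalar, which lies outside the free carrier;
      closure under scalars takes the place of closure under multiplication.\<close>
    proof (cases "u = []")
      case True
      then show ?thesis
        using E.I_smult[OF xy, of c] by (simp add: scalar_commute)
    next
      case False
      then show ?thesis
        using xy cons.prems j by (intro E.I_mult_right free_carrier_single) auto
    qed
    then show ?thesis
      by (simp add: j mult_single plus_list_def)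
  next
    case False
    then have "Poly_Mapping.single [x] 1 * Poly_Mapping.single w c \<in> E.I"
      using cons by (intro E.I_mult_left free_carrier_single cons.IH) auto
    then show ?thesis
      by (simp add: mult_single plus_list_def)
  qed
qed

text \<open>A word inside one copy is restored by the summand of that copy and killed by all others;
  a mixed word is killed by every summand and lies in the ideal. Since \<open>T\<close> may be
  infinite, the sum runs over a finite \<open>J\<close> covering the letters of f.\<close>

lemma decomposition_mod_ideal:
  assumes J: "finite J" "J \<subseteq> T"
    and f: "Poly_Mapping.keys f \<subseteq> lists (\<Union>i\<in>J. lpa_generators (\<Omega> i)) - {[]}"
  shows "f - (\<Sum>i\<in>J. embed i (proj i f)) \<in> E.I"
  using f
proof (rule poly_mapping_monomial_induct)
  show "0 - (\<Sum>i\<in>J. embed i (proj i 0)) \<in> E.I"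
    by (simp add: embed_def proj_def E.I_zero)
next
  fix f g
  assume "f - (\<Sum>i\<in>J. embed i (proj i f)) \<in> E.I" "g - (\<Sum>i\<in>J. embed i (proj i g)) \<in> E.I"
  then show "f + g - (\<Sum>i\<in>J. embed i (proj i (f + g))) \<in> E.I"
    using E.I_add by (fastforce simp: embed_def proj_def free_lift_add sum.distrib algebra_simps)
next
  fix w and c :: 'k
  assume w: "w \<in> lists (\<Union>i\<in>J. lpa_generators (\<Omega> i)) - {[]}"
  let ?f = "Poly_Mapping.single w c"
  show "?f - (\<Sum>i\<in>J. embed i (proj i ?f)) \<in> E.I"
  proof (cases "\<exists>i\<in>J. set w \<subseteq> lpa_generators (\<Omega> i)")
    case True
    then obtain i where i: "i \<in> J" "set w \<subseteq> lpa_generators (\<Omega> i)" by blast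
    have "embed j (proj j ?f) = (if j = i then ?f else 0)" if "j \<in> J" for j
    proof (cases "j = i")
      case True
      have "map (from_D i) (map (to_D i) w) = w"
        using i J by (auto intro!: map_idI from_D_to_D[of i])
      then show ?thesis
        using True i J by (simp add: proj_single[OF _ i(2)] embed_single subset_iff)
    next
      case False
      then have "\<not> set w \<subseteq> lpa_generators (\<Omega> j)"
        using i w that subsetD[OF J(2)] generators_disjoint[of i j] by (cases w) auto
      then show ?thesis
        using False by (simp add: proj_single_0 embed_def)
    qed
    then have "(\<Sum>j\<in>J. embed j (proj j ?f)) = ?f"
      using J i by (simp add: sum.delta)
    then show ?thesis by (simp add: E.I_zero)
  next
    case False
    have "embed j (proj j ?f) = 0" if "j \<in> J" for j
      using that False by (simp add: proj_single_0 embed_def)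
    moreover have "?f \<in> E.I"
    proof (rule mixed_word_in_ideal)
      \<comment> \<open>The case assumption speaks of indices in \<open>J\<close> only. A copy
        outside \<open>J\<close> contains no letter of w at all.\<close>
      show "\<not> set w \<subseteq> lpa_generators (\<Omega> i)" if "i \<in> T" for i
      proof (cases "i \<in> J")
        case True
        then show ?thesis using False by blast
      next
        case 2: False
        obtain x j where "x \<in> set w" "j \<in> J" "x \<in> lpa_generators (\<Omega> j)"
          using w by (cases w) auto
        then show ?thesis
          using 2 that J generators_disjoint[of i j] by blast
      qed
    qed (use w J in \<open>fastforce simp: generators_E\<close>)+
    ultimately show ?thesis by simp
  qed
qed

text \<open>Finitely many words with finitely many letters touch finitely many copies, collected in
  \<open>J\<close>. As the words are nonempty, each has a letter that a coordinate outside
  \<open>J\<close> kills.\<close>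

lemma finite_support:
  assumes "f \<in> free_carrier (lpa_generators E)"
  obtains J where "finite J" "J \<subseteq> T"
    "Poly_Mapping.keys f \<subseteq> lists (\<Union>i\<in>J. lpa_generators (\<Omega> i)) - {[]}"
    "\<And>i. i \<in> T \<Longrightarrow> i \<notin> J \<Longrightarrow> proj i f = 0"
proof -
  let ?L = "\<Union>w\<in>Poly_Mapping.keys f. set w"
  have "?L \<subseteq> lpa_generators E"
    using assms by (auto simp: free_carrier_def)
  then have "\<forall>x\<in>?L. \<exists>i. i \<in> T \<and> x \<in> lpa_generators (\<Omega> i)"
    unfolding generators_E by blast
  then obtain k where k: "\<And>x. x \<in> ?L \<Longrightarrow> k x \<in> T \<and> x \<in> lpa_generators (\<Omega> (k x))"
    by metis
  show thesis
  proof (rule that[of "k ` ?L"])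
    show keys: "Poly_Mapping.keys f \<subseteq> lists (\<Union>i\<in>k ` ?L. lpa_generators (\<Omega> i)) - {[]}"
      using assms k by (fastforce simp: free_carrier_def)
    show "proj i f = 0" if "i \<in> T" "i \<notin> k ` ?L" for i
      unfolding proj_def
    proof (rule free_lift_eq_0[OF subset_refl])
      fix w assume w: "w \<in> Poly_Mapping.keys f"
      then obtain x where "x \<in> set w"
        using keys by (cases w) auto
      then show "\<exists>x\<in>set w. (if x \<in> lpa_generators (\<Omega> i) then Poly_Mapping.single [to_D i x] 1 else 0) = 0"
        using w that k[of x] generators_disjoint[of i "k x" x] by (intro bexI[of _ x]) auto
    qed
  qed (use k in auto)
qed

text \<open>This determines the kernel. If all coordinates lie in the ideal of \<open>D\<close>,
  their images under \<open>embed\<close> lie in the ideal of \<open>E\<close>, and f is congruent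
  to the sum of these images.\<close>

lemma in_ideal_iff:
  assumes f: "f \<in> free_carrier (lpa_generators E)"
  shows "f \<in> E.I \<longleftrightarrow> (\<forall>i\<in>T. proj i f \<in> D.I)"
proof
  assume proj: "\<forall>i\<in>T. proj i f \<in> D.I"
  obtain J where J: "finite J" "J \<subseteq> T"
    "Poly_Mapping.keys f \<subseteq> lists (\<Union>i\<in>J. lpa_generators (\<Omega> i)) - {[]}"
    using finite_support[OF f] by metis
  have "(\<Sum>i\<in>J. embed i (proj i f)) \<in> E.I"
    using proj J by (intro E.I_sum embed_ideal) auto
  then show "f \<in> E.I"
    using E.I_add[OF decomposition_mod_ideal[OF J]] by fastforce
qed (simp add: proj_ideal)

text \<open>The first isomorphism theorem applies to the map taking f to the classes of its
  coordinates. Its values have finite support by \<open>finite_support\<close>, and its kernel is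
  given by \<open>in_ideal_iff\<close>.\<close>

lemma lpa_isomorphic_direct_sum:
  "algebra_isomorphic (leavitt_path_algebra K E) (algebra_direct_sum T (leavitt_path_algebra K D))"
proof -
  let ?\<Phi> = "\<lambda>f. \<lambda>i\<in>T. D.cls (proj i f)"
  have "algebra_isomorphic E.quot (algebra_direct_sum T D.quot)"
  proof (rule E.quot_isomorphic[where \<Phi> = ?\<Phi>])
    fix f :: "('v, 'e) lpa_generator list \<Rightarrow>\<^sub>0 'k"
    assume f: "f \<in> free_carrier (lpa_generators E)"
    obtain J where J: "finite J" "\<And>i. i \<in> T \<Longrightarrow> i \<notin> J \<Longrightarrow> proj i f = 0"
      using finite_support[OF f] by metis
    have "finite {i \<in> T. ?\<Phi> f i \<noteq> \<zero>\<^bsub>D.quot\<^esub>}"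
      by (rule finite_subset[OF _ J(1)]) (use J(2) in \<open>auto simp: D.quot_zero\<close>)
    then show "?\<Phi> f \<in> carrier (algebra_direct_sum T D.quot)"
      using f proj_closed by (auto simp: algebra_direct_sum_def D.carrier_quot)
    show "?\<Phi> (Poly_Mapping.single [] c * f) = c \<odot>\<^bsub>algebra_direct_sum T D.quot\<^esub> ?\<Phi> f" for c
      by (simp add: algebra_direct_sum_def D.quot_smult proj_def free_lift_smult cong: restrict_cong)
    fix g :: "('v, 'e) lpa_generator list \<Rightarrow>\<^sub>0 'k"
    assume g: "g \<in> free_carrier (lpa_generators E)"
    show "?\<Phi> (f + g) = ?\<Phi> f \<oplus>\<^bsub>algebra_direct_sum T D.quot\<^esub> ?\<Phi> g"
      by (simp add: algebra_direct_sum_def D.quot_add proj_def free_lift_add cong: restrict_cong)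
    show "?\<Phi> (f * g) = ?\<Phi> f \<otimes>\<^bsub>algebra_direct_sum T D.quot\<^esub> ?\<Phi> g"
      using D.quot_mult[OF proj_closed[OF _ f] proj_closed[OF _ g]]
      by (simp add: algebra_direct_sum_def free_lift_mult proj_def cong: restrict_cong)
    have "?\<Phi> f = ?\<Phi> g \<longleftrightarrow> (\<forall>i\<in>T. D.cls (proj i f) = D.cls (proj i g))"
      by (auto simp: restrict_def fun_eq_iff)
    also have "\<dots> \<longleftrightarrow> f - g \<in> E.I"
      by (simp add: in_ideal_iff[OF free_carrier_diff[OF f g]] D.cls_eq_iff proj_def free_lift_diff)
    finally show "?\<Phi> f = ?\<Phi> g \<longleftrightarrow> f - g \<in> E.I" .
  next
    fix b assume b: "b \<in> carrier (algebra_direct_sum T D.quot)"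
    let ?J = "{i \<in> T. b i \<noteq> \<zero>\<^bsub>D.quot\<^esub>}"
    have "\<forall>i\<in>T. \<exists>y. y \<in> free_carrier (lpa_generators D) \<and> b i = D.cls y"
      using b by (auto simp: algebra_direct_sum_def D.carrier_quot)
    then obtain y where y: "\<And>i. i \<in> T \<Longrightarrow> y i \<in> free_carrier (lpa_generators D)"
        "\<And>i. i \<in> T \<Longrightarrow> b i = D.cls (y i)"
      by metis
    \<comment> \<open>A preimage of b: representatives of its finitely many nonzero coordinates,
      each embedded in its own copy.\<close>
    let ?f = "\<Sum>i\<in>?J. embed i (y i)"
    have fin: "finite ?J"
      using b by (simp add: algebra_direct_sum_def)
    have "D.cls (proj j ?f) = b j" if j: "j \<in> T" for j
    proof -
      have "proj j ?f = (\<Sum>i\<in>?J. proj j (embed i (y i)))"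
        by (simp add: proj_def free_lift_sum)
      also have "\<dots> = (\<Sum>i\<in>?J. if i = j then y i else 0)"
        using j y by (intro sum.cong) (auto simp: proj_embed)
      also have "\<dots> = (if j \<in> ?J then y j else 0)"
        using fin by (simp add: sum.delta)
      finally show ?thesis
        using j y D.quot_zero by auto
    qed
    moreover have "b \<in> extensional T"
      using b by (auto simp: algebra_direct_sum_def PiE_def)
    ultimately have "?\<Phi> ?f = b"
      by (auto simp: extensional_def restrict_def fun_eq_iff)
    moreover have "?f \<in> free_carrier (lpa_generators E)"
      using y embed_closed by (intro free_carrier_sum) auto
    ultimately show "\<exists>f\<in>free_carrier (lpa_generators E). ?\<Phi> f = b" by blast
  qed
  then show ?thesis
    by (simp add: leavitt_path_algebra_def Let_def)
qed

end

corollary lpa_disjoint_union_isomorphic: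
  fixes K :: "'k::field itself"
  assumes "is_disjoint_union E T \<Omega>" "\<And>i. i \<in> T \<Longrightarrow> digraph_iso (\<Omega> i) D"
    and "wf_digraph E" "wf_digraph D"
  shows "algebra_isomorphic (leavitt_path_algebra K E) (algebra_direct_sum T (leavitt_path_algebra K D))"
proof -
  have "\<forall>i\<in>T. \<exists>h. pre_digraph.digraph_isomorphism (\<Omega> i) h \<and> app_iso h (\<Omega> i) = D"
    using assms(2) unfolding digraph_iso_def by blast
  then obtain h where "\<And>i. i \<in> T \<Longrightarrow> pre_digraph.digraph_isomorphism (\<Omega> i) (h i)"
      "\<And>i. i \<in> T \<Longrightarrow> app_iso (h i) (\<Omega> i) = D"
    by metis
  then interpret copies_of_graph K E T \<Omega> D h
    by (intro copies_of_graph.intro) (use assms in auto)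
  show ?thesis by (rule lpa_isomorphic_direct_sum)
qed

section \<open>Hopf graphs\<close>

lemma (in group) mult_inv_cancel:
  assumes "x \<in> carrier G" "y \<in> carrier G"
  shows "x \<otimes> (inv x \<otimes> y) = y" "inv x \<otimes> (x \<otimes> y) = y"
  using assms by (simp_all flip: m_assoc)

lemma (in group) mem_l_coset_iff:
  assumes "subgroup N G" "x \<in> carrier G"
  shows "y \<in> x <# N \<longleftrightarrow> y \<in> carrier G \<and> inv x \<otimes> y \<in> N"
proof
  interpret N: subgroup N G by fact
  assume "y \<in> x <# N"
  then obtain n where "n \<in> N" "y = x \<otimes> n"
    by (auto simp: l_coset_def)
  then show "y \<in> carrier G \<and> inv x \<otimes> y \<in> N"
    using assms by (simp add: inv_solve_left' flip: m_assoc)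
next
  assume "y \<in> carrier G \<and> inv x \<otimes> y \<in> N"
  moreover from this have "y = x \<otimes> (inv x \<otimes> y)"
    using assms by (simp flip: m_assoc)
  ultimately show "y \<in> x <# N"
    unfolding l_coset_def by blast
qed

lemma (in group) l_coset_eq_iff:
  assumes "subgroup N G" "x \<in> carrier G" "y \<in> carrier G"
  shows "x <# N = y <# N \<longleftrightarrow> inv x \<otimes> y \<in> N"
proof -
  interpret N: subgroup N G by fact
  have "x <# N = y <# N" if xy: "inv x \<otimes> y \<in> N"
  proof -
    have "inv x \<otimes> z = (inv x \<otimes> y) \<otimes> (inv y \<otimes> z)" if "z \<in> carrier G" for z
      using that assms by (simp add: m_assoc mult_inv_cancel)
    moreover have "inv y \<otimes> z = inv (inv x \<otimes> y) \<otimes> (inv x \<otimes> z)" if "z \<in> carrier G" for z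
      using that assms by (simp add: inv_mult_group m_assoc mult_inv_cancel)
    ultimately have "inv x \<otimes> z \<in> N \<longleftrightarrow> inv y \<otimes> z \<in> N" if "z \<in> carrier G" for z
      using that xy N.m_closed N.m_inv_closed by metis
    then show ?thesis
      using assms by (auto simp: mem_l_coset_iff)
  qed
  moreover have "inv x \<otimes> y \<in> N" if "x <# N = y <# N"
    using that assms mem_l_coset_iff[of N y y] mem_l_coset_iff[of N x y] by simp
  ultimately show ?thesis by blast
qed

text \<open>Left multiplication by an element of \<open>S\<close> is injective, hence surjective on
  the finite set \<open>S\<close>. Solving s e = s inside \<open>S\<close> yields the identity, and
  solving a b = 1 yields the inverses.\<close>

lemma finite_subsemigroup_is_subgroup:
  fixes G (structure)
  assumes "group G" "finite S" "S \<noteq> {}" "S \<subseteq> carrier G"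
    and mult: "\<And>x y. x \<in> S \<Longrightarrow> y \<in> S \<Longrightarrow> x \<otimes> y \<in> S"
  shows "subgroup S G"
proof -
  interpret group G by fact
  have solve: "\<exists>y\<in>S. x \<otimes> y = z" if "x \<in> S" "z \<in> S" for x z
  proof -
    have "inj_on ((\<otimes>) x) S"
      using that assms(4) by (intro inj_onI) (metis Units_eq Units_l_cancel subsetD)
    then have "(\<otimes>) x ` S = S"
      using that mult assms(2) by (intro endo_inj_surj) auto
    then show ?thesis using that by (metis imageE)
  qed
  obtain s where s: "s \<in> S" using assms(3) by blast
  then obtain e where e: "e \<in> S" "s \<otimes> e = s" using solve by blast
  then have one: "\<one> \<in> S"
    using s assms(4) l_cancel_one by (metis subsetD)
  show ?thesis
  proof (rule subgroupI)
    fix a assume a: "a \<in> S"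
    then obtain b where "b \<in> S" "a \<otimes> b = \<one>" using solve one by blast
    then show "inv a \<in> S"
      using a assms(4) by (metis inv_equality inv_inv subsetD inv_comm)
  qed (use assms in auto)
qed

section \<open>The semigroup of a ramification data and its normal subgroups\<close>

locale ramified_group = group G for G :: "('a, 'm) monoid_scheme" (structure) +
  fixes \<rr> :: "'a set \<Rightarrow> nat"
begin

abbreviation \<Gamma> where "\<Gamma> \<equiv> hopf_graph G \<rr>"
abbreviation S where "S \<equiv> hopf_semigroup G \<rr>"
abbreviation A where "A \<equiv> \<Union> (ram_supp G \<rr>)"

text \<open>The added identity accounts for paths of length 0, so that \<open>M\<close> describes
  reachability whether or not \<open>\<one>\<close> lies in \<open>S\<close>.\<close>

definition M where "M = insert \<one> S"
definition V where "V = generate G S"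
text \<open>One formula for both cases of \<open>Lambda\<close>: the largest subgroup in
  \<open>S\<close> if \<open>S\<close> is a submonoid, and \<open>{\<one>}\<close>
  otherwise.\<close>

definition U where "U = {x \<in> M. inv x \<in> M}"

lemma conj_class_closed: "C \<in> conjugacy_classes G \<Longrightarrow> C \<subseteq> carrier G"
  by (auto simp: conjugacy_classes_def)

lemma conj_class_conj:
  assumes "C \<in> conjugacy_classes G" "c \<in> C" "g \<in> carrier G"
  shows "g \<otimes> c \<otimes> inv g \<in> C"
proof -
  obtain x where x: "x \<in> carrier G" "C = {g \<otimes> x \<otimes> inv g |g. g \<in> carrier G}"
    using assms by (auto simp: conjugacy_classes_def)
  then obtain k where "k \<in> carrier G" "c = k \<otimes> x \<otimes> inv k"
    using assms by auto
  moreover from this have "g \<otimes> c \<otimes> inv g = (g \<otimes> k) \<otimes> x \<otimes> inv (g \<otimes> k)"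
    using x assms by (simp add: inv_mult_group m_assoc)
  ultimately show ?thesis
    using x assms by blast
qed

lemma A_closed: "A \<subseteq> carrier G"
  using conj_class_closed by (auto simp: ram_supp_def)

lemma A_conj: "a \<in> A \<Longrightarrow> g \<in> carrier G \<Longrightarrow> g \<otimes> a \<otimes> inv g \<in> A"
  using conj_class_conj by (auto simp: ram_supp_def)

lemma S_closed: "S \<subseteq> carrier G"
proof
  fix x assume "x \<in> S"
  then show "x \<in> carrier G"
    unfolding hopf_semigroup_def by induction (use A_closed in auto)
qed

lemma S_mult: "x \<in> S \<Longrightarrow> y \<in> S \<Longrightarrow> x \<otimes> y \<in> S"
  unfolding hopf_semigroup_def by (rule semigroup_generated.mult)

lemma A_subset_S: "A \<subseteq> S"
  unfolding hopf_semigroup_def by (blast intro: semigroup_generated.base)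

lemma conj_mult:
  assumes "g \<in> carrier G" "x \<in> carrier G" "y \<in> carrier G"
  shows "g \<otimes> (x \<otimes> y) \<otimes> inv g = (g \<otimes> x \<otimes> inv g) \<otimes> (g \<otimes> y \<otimes> inv g)"
  using assms by (simp add: m_assoc mult_inv_cancel)

text \<open>The generating set is a union of conjugacy classes and conjugation respects products.
  The normality of \<open>V\<close> and \<open>U\<close> rests on this.\<close>

lemma S_conj:
  assumes "x \<in> S" "g \<in> carrier G"
  shows "g \<otimes> x \<otimes> inv g \<in> S"
  using assms(1) unfolding hopf_semigroup_def
proof induction
  case (base a)
  then show ?case
    using A_conj assms(2) by (blast intro: semigroup_generated.base)
next
  case (mult a b)
  then have "a \<in> carrier G" "b \<in> carrier G"
    using S_closed by (auto simp: hopf_semigroup_def)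
  then show ?case
    using mult.IH assms(2) by (simp add: conj_mult semigroup_generated.mult)
qed

lemma S_empty_iff: "S = {} \<longleftrightarrow> A = {}"
proof -
  have "A \<noteq> {}" if "x \<in> S" for x
    using that unfolding hopf_semigroup_def by induction auto
  then show ?thesis
    using A_subset_S by blast
qed

text \<open>Conjugacy classes are nonempty, so a class of positive multiplicity contributes a
  generator.\<close>

lemma ram_zero_iff: "ram_zero G \<rr> \<longleftrightarrow> S = {}"
proof -
  have "C \<noteq> {}" if "C \<in> conjugacy_classes G" for C
    using that by (auto simp: conjugacy_classes_def)
  then show ?thesis
    unfolding S_empty_iff by (auto simp: ram_zero_def ram_supp_def)
qed

lemma M_closed: "M \<subseteq> carrier G"
  using S_closed by (simp add: M_def)

lemma M_mult: "x \<in> M \<Longrightarrow> y \<in> M \<Longrightarrow> x \<otimes> y \<in> M"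
  using S_mult S_closed by (auto simp: M_def)

lemma M_one: "\<one> \<in> M"
  by (simp add: M_def)

lemma M_conj: "x \<in> M \<Longrightarrow> g \<in> carrier G \<Longrightarrow> g \<otimes> x \<otimes> inv g \<in> M"
  using S_conj by (auto simp: M_def)

lemma V_normal: "V \<lhd> G"
  unfolding V_def by (rule normal_generateI[OF S_closed S_conj])

lemma V_subgroup: "subgroup V G"
  using V_normal by (rule normal_imp_subgroup)

lemma S_subset_V: "S \<subseteq> V"
  unfolding V_def by (blast intro: generate.incl)

lemma M_subset: "subgroup N G \<Longrightarrow> S \<subseteq> N \<Longrightarrow> M \<subseteq> N"
  by (auto simp: M_def subgroup.one_closed)

lemma U_subset_M: "U \<subseteq> M"
  by (auto simp: U_def)

lemma U_subgroup: "subgroup U G"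
proof (rule subgroupI)
  show "U \<subseteq> carrier G"
    using U_subset_M M_closed by blast
  show "U \<noteq> {}"
    using M_one by (force simp: U_def)
next
  fix a assume "a \<in> U"
  then show "inv a \<in> U"
    using M_closed by (auto simp: U_def)
next
  fix a b assume "a \<in> U" "b \<in> U"
  then show "a \<otimes> b \<in> U"
    using M_closed M_mult by (auto simp: U_def inv_mult_group subset_iff)
qed

lemma U_normal: "U \<lhd> G"
proof -
  have "g \<otimes> x \<otimes> inv g \<in> U" if "g \<in> carrier G" "x \<in> U" for g x
  proof -
    have x: "x \<in> carrier G" "x \<in> M" "inv x \<in> M"
      using that M_closed by (auto simp: U_def)
    then have "inv (g \<otimes> x \<otimes> inv g) = g \<otimes> inv x \<otimes> inv g"
      using that by (simp add: inv_mult_group m_assoc)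
    then show ?thesis
      using x that by (simp add: U_def M_conj)
  qed
  then show ?thesis
    using U_subgroup by (simp add: normal_inv_iff)
qed

lemma U_unique: "subgroup H G \<Longrightarrow> H \<subseteq> M \<Longrightarrow> H \<subseteq> U"
  using subgroup.m_inv_closed by (fastforce simp: U_def)

lemma submonoid_iff: "submonoid S G \<longleftrightarrow> \<one> \<in> S"
  using S_closed S_mult submonoid.one_closed by (blast intro: submonoid.intro)

text \<open>An element x \<noteq> 1 of \<open>U\<close> would put x and its inverse into
  \<open>S\<close>, hence also their product 1, and \<open>S\<close> would be a submonoid.\<close>

lemma U_trivial: "\<not> submonoid S G \<Longrightarrow> U = {\<one>}"
proof -
  assume "\<not> submonoid S G"
  then have one: "\<one> \<notin> S"
    by (simp add: submonoid_iff)
  have "x = \<one>" if "x \<in> U" for x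
  proof (rule ccontr)
    assume "x \<noteq> \<one>"
    then have "x \<in> S" "inv x \<in> S"
      using that S_closed by (auto simp: U_def M_def subset_iff)
    then have "\<one> \<in> S"
      using S_mult[of x "inv x"] S_closed by (auto simp: subset_iff)
    then show False using one by blast
  qed
  then show "U = {\<one>}"
    using subgroup.one_closed[OF U_subgroup] by blast
qed

lemma U_eq_largest: "submonoid S G \<Longrightarrow> largest_subgroup_in G S = U"
proof -
  assume S: "submonoid S G"
  then have "M = S"
    by (auto simp: M_def submonoid_iff)
  moreover from this have "U \<subseteq> largest_subgroup_in G S"
    using U_subset_M U_subgroup by (intro largest_subgroup_in_submonoid(3)[OF S]) auto
  ultimately show ?thesis
    using U_unique[OF largest_subgroup_in_submonoid(1)[OF S]] largest_subgroup_in_submonoid(2)[OF S]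
    by auto
qed

section \<open>Arcs of the Hopf graph\<close>

lemma \<Gamma>_simps [simp]:
  "verts \<Gamma> = carrier G" "tail \<Gamma> (x, C, c, i) = x" "head \<Gamma> (x, C, c, i) = x \<otimes> c"
  "(x, C, c, i) \<in> arcs \<Gamma> \<longleftrightarrow> x \<in> carrier G \<and> C \<in> conjugacy_classes G \<and> c \<in> C \<and> i < \<rr> C"
  by (simp_all add: hopf_graph_def)

lemma arc_cases:
  assumes "e \<in> arcs \<Gamma>"
  obtains x C c i where "e = (x, C, c, i)" "x \<in> carrier G" "C \<in> conjugacy_classes G" "c \<in> C"
    "i < \<rr> C" "c \<in> A" "c \<in> carrier G"
  using assms conj_class_closed by (cases e) (fastforce simp: ram_supp_def)

sublocale \<Gamma>: wf_digraph \<Gamma>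
  by standard (auto elim!: arc_cases)

lemma arc_from:
  assumes "x \<in> carrier G" "a \<in> A"
  obtains e where "e \<in> arcs \<Gamma>" "tail \<Gamma> e = x" "head \<Gamma> e = x \<otimes> a"
proof -
  obtain C where "C \<in> conjugacy_classes G" "\<rr> C > 0" "a \<in> C"
    using assms by (auto simp: ram_supp_def)
  then show thesis
    using assms that[of "(x, C, a, 0)"] by simp
qed

section \<open>Induced subgraphs, reachability and translations\<close>

lemma wf_induced: "wf_digraph (\<Gamma> \<restriction> N)"
  by (rule \<Gamma>.wellformed_induce_subgraph)

lemma induced_carrier: "\<Gamma> \<restriction> carrier G = \<Gamma>"
  by (auto simp: induce_subgraph_def intro!: pre_digraph.equality elim!: arc_cases)

lemma induced_induced: "N \<subseteq> N' \<Longrightarrow> (\<Gamma> \<restriction> N') \<restriction> N = \<Gamma> \<restriction> N"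
  by (auto simp: induce_subgraph_def)

lemma induced_dominates:
  assumes "x \<in> N" "x \<otimes> a \<in> N" "x \<in> carrier G" "a \<in> A"
  shows "x \<rightarrow>\<^bsub>\<Gamma> \<restriction> N\<^esub> (x \<otimes> a)"
proof -
  obtain e where "e \<in> arcs \<Gamma>" "tail \<Gamma> e = x" "head \<Gamma> e = x \<otimes> a"
    using assms arc_from by blast
  then show ?thesis
    using assms by (auto simp: arcs_ends_conv intro!: rev_image_eqI)
qed

text \<open>\<open>Delta\<close> restricts only the ranges of the arcs, but from xc in
  \<open>V\<close> and c in \<open>V\<close> it follows that x is in \<open>V\<close>. For zero
  ramification \<open>V\<close> is trivial and there are no arcs.\<close>

lemma Delta_eq: "Delta G \<rr> = \<Gamma> \<restriction> V"
proof (cases "ram_zero G \<rr>")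
  case True
  then have "V = {\<one>}"
    using ram_zero_iff generate_empty by (simp add: V_def)
  moreover have "arcs \<Gamma> = {}"
    using True by (auto simp: ram_zero_def hopf_graph_def)
  ultimately show ?thesis
    using True by (simp add: Delta_def trivial_subgraph_def induce_subgraph_def)
next
  case False
  have "tail \<Gamma> e \<in> V" if "e \<in> arcs \<Gamma>" "head \<Gamma> e \<in> V" for e
    using that(1)
  proof (cases rule: arc_cases)
    case (1 x C c i)
    then have "x = (x \<otimes> c) \<otimes> inv c" "c \<in> V"
      using A_subset_S S_subset_V by (auto simp: m_assoc)
    then show ?thesis
      using 1 that V_subgroup by (metis \<Gamma>_simps(2,3) subgroup.m_closed subgroup.m_inv_closed)
  qed
  then show ?thesis
    using False unfolding Delta_def Let_def induce_subgraph_def V_def[symmetric] by auto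
qed

text \<open>When \<open>S\<close> is not a submonoid, \<open>U\<close> is trivial and the single
  vertex must carry no loop: the label of a loop would be 1, which is not in
  \<open>S\<close>.\<close>

lemma Lambda_eq: "Lambda G \<rr> = \<Gamma> \<restriction> U"
proof (cases "submonoid S G")
  case True
  then show ?thesis
    using U_eq_largest by (auto simp: Lambda_def Let_def induce_subgraph_def)
next
  case False
  have "arcs (\<Gamma> \<restriction> {\<one>}) = {}"
  proof -
    have False if "e \<in> arcs (\<Gamma> \<restriction> {\<one>})" for e
    proof -
      have "e \<in> arcs \<Gamma>" using that by simp
      then show False
      proof (cases rule: arc_cases)
        case (1 x C c i)
        then show ?thesis
          using that False A_subset_S by (auto simp: submonoid_iff)
      qed
    qed
    then show ?thesis by blast
  qed
  then show ?thesis
    using False U_trivial by (simp add: Lambda_def trivial_subgraph_def induce_subgraph_def)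
qed

text \<open>Induction on the generation of s, with paths concatenated for a product. The path stays
  in \<open>N\<close> because a translate of \<open>S\<close> does, and this condition passes from x
  to xa since \<open>S\<close> is closed under products. The set \<open>N\<close> is general enough
  to serve for subgroups and for cosets of \<open>V\<close>.\<close>

lemma reachable_mult:
  assumes N: "\<And>s. s \<in> S \<Longrightarrow> x \<otimes> s \<in> N" "x \<in> N" "N \<subseteq> carrier G" and s: "s \<in> S"
  shows "x \<rightarrow>\<^sup>*\<^bsub>\<Gamma> \<restriction> N\<^esub> (x \<otimes> s)"
  using s N(1,2) unfolding hopf_semigroup_def
proof (induction arbitrary: x)
  interpret N: wf_digraph "\<Gamma> \<restriction> N" by (rule wf_induced)
  {
    case (base a)
    then show ?case
      using A_subset_S N(3)
      by (intro N.reachable_adjI induced_dominates) (auto simp: semigroup_generated.base)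
  next
    case (mult a b)
    have ab: "a \<in> carrier G" "b \<in> carrier G" "x \<in> carrier G"
      using mult.hyps mult.prems S_closed N(3) by (auto simp: hopf_semigroup_def)
    have "x \<otimes> a \<otimes> s \<in> N" if "s \<in> semigroup_generated G A" for s
    proof -
      have "s \<in> carrier G"
        using that S_closed by (auto simp: hopf_semigroup_def)
      then show ?thesis
        using mult.prems(1)[OF semigroup_generated.mult[OF mult.hyps(1) that]] ab
        by (simp add: m_assoc)
    qed
    then have "x \<rightarrow>\<^sup>*\<^bsub>\<Gamma> \<restriction> N\<^esub> (x \<otimes> a)" "(x \<otimes> a) \<rightarrow>\<^sup>*\<^bsub>\<Gamma> \<restriction> N\<^esub> (x \<otimes> a \<otimes> b)"
      using mult by blast+
    then have "x \<rightarrow>\<^sup>*\<^bsub>\<Gamma> \<restriction> N\<^esub> (x \<otimes> a \<otimes> b)"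
      by (rule N.reachable_trans)
    then show ?case
      using ab by (simp add: m_assoc)
  }
qed

text \<open>Each arc multiplies on the right by a generator, which keeps the quotient in
  \<open>M\<close>; conversely \<open>reachable_mult\<close> realises every element of
  \<open>S\<close>. The criterion is the same for all subgroups containing \<open>S\<close>, so it
  covers both \<Gamma> and \<Delta>.\<close>

lemma reachable_iff:
  assumes N: "subgroup N G" "S \<subseteq> N"
  shows "x \<rightarrow>\<^sup>*\<^bsub>\<Gamma> \<restriction> N\<^esub> y \<longleftrightarrow> x \<in> N \<and> y \<in> N \<and> inv x \<otimes> y \<in> M"
proof
  interpret N: subgroup N G by fact
  interpret \<Gamma>N: wf_digraph "\<Gamma> \<restriction> N" by (rule wf_induced)
  show "x \<in> N \<and> y \<in> N \<and> inv x \<otimes> y \<in> M" if "x \<rightarrow>\<^sup>*\<^bsub>\<Gamma> \<restriction> N\<^esub> y"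
    using that
  proof (induction rule: \<Gamma>N.reachable_induct)
    case base
    then show ?case
      by (simp add: M_one)
  next
    case (step y z)
    obtain e where e: "e \<in> arcs \<Gamma>" "tail \<Gamma> e = y" "head \<Gamma> e = z" "z \<in> N"
      using step by (auto simp: arcs_ends_conv)
    from e(1) show ?case
    proof (cases rule: arc_cases)
      case (1 u C c i)
      then have "inv x \<otimes> z = (inv x \<otimes> y) \<otimes> c" "c \<in> M"
        using e step A_subset_S by (auto simp: M_def m_assoc)
      then show ?thesis
        using step e M_mult by simp
    qed
  qed
  show "x \<rightarrow>\<^sup>*\<^bsub>\<Gamma> \<restriction> N\<^esub> y" if xy: "x \<in> N \<and> y \<in> N \<and> inv x \<otimes> y \<in> M"
  proof -
    have y: "y = x \<otimes> (inv x \<otimes> y)"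
      using xy by (simp flip: m_assoc)
    show ?thesis
    \<comment> \<open>The identity may be missing from \<open>S\<close>; it belongs to the path of
      length 0.\<close>
    proof (cases "inv x \<otimes> y = \<one>")
      case True
      then show ?thesis using xy y by simp
    next
      case False
      then have "x \<rightarrow>\<^sup>*\<^bsub>\<Gamma> \<restriction> N\<^esub> (x \<otimes> (inv x \<otimes> y))"
        using xy N(2) by (intro reachable_mult) (auto simp: M_def)
      then show ?thesis using y by simp
    qed
  qed
qed

text \<open>Arcs multiply on the right, so left multiplication commutes with them: it moves the
  source of an arc and keeps its label. As \<open>N\<close> is arbitrary, this applies to the cosets
  of \<open>V\<close> and of \<open>U\<close> alike.\<close>

lemma translate_iso:
  assumes u: "u \<in> carrier G" and N: "N \<subseteq> carrier G"
  shows "digraph_iso (\<Gamma> \<restriction> (u <# N)) (\<Gamma> \<restriction> N)"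
proof -
  \<comment> \<open>The maps \<open>iso_head\<close> and \<open>iso_tail\<close> are those of
    \<Gamma>, because the image has to equal the induced subgraph as a record.\<close>
  define h where "h = \<lparr>iso_verts = (\<lambda>x. inv u \<otimes> x), iso_arcs = (\<lambda>(x, C, c, i). (inv u \<otimes> x, C, c, i)),
    iso_head = head \<Gamma>, iso_tail = tail \<Gamma>\<rparr>"
  have closed: "u <# N \<subseteq> carrier G"
    using u N by (auto simp: l_coset_def)
  note cancel = mult_inv_cancel[OF u]
  have mem: "x \<in> u <# N \<longleftrightarrow> inv u \<otimes> x \<in> N" if "x \<in> carrier G" for x
    using that u N cancel by (force simp: l_coset_def subset_iff)
  have "pre_digraph.digraph_isomorphism (\<Gamma> \<restriction> (u <# N)) h"
    unfolding pre_digraph.digraph_isomorphism_def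
  proof (intro conjI ballI)
    show "inj_on (iso_verts h) (verts (\<Gamma> \<restriction> (u <# N)))"
      using closed u by (auto simp: h_def subset_iff intro!: inj_onI)
    show "inj_on (iso_arcs h) (arcs (\<Gamma> \<restriction> (u <# N)))"
      using u by (auto simp: h_def elim!: arc_cases intro!: inj_onI)
    show "wf_digraph (\<Gamma> \<restriction> (u <# N))"
      by (rule wf_induced)
    fix e assume "e \<in> arcs (\<Gamma> \<restriction> (u <# N))"
    then have "e \<in> arcs \<Gamma>" by simp
    then show "iso_verts h (tail (\<Gamma> \<restriction> (u <# N)) e) = iso_tail h (iso_arcs h e)"
      "iso_verts h (head (\<Gamma> \<restriction> (u <# N)) e) = iso_head h (iso_arcs h e)"
      using u by (auto simp: h_def m_assoc elim!: arc_cases)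
  qed
  moreover have "\<Gamma> \<restriction> N = app_iso h (\<Gamma> \<restriction> (u <# N))"
  proof (rule pre_digraph.equality)
    have "u <# N = (\<otimes>) u ` N"
      by (auto simp: l_coset_def)
    moreover have "(\<lambda>x. inv u \<otimes> (u \<otimes> x)) ` N = (\<lambda>x. x) ` N"
      using N cancel by (intro image_cong) auto
    ultimately show "verts (\<Gamma> \<restriction> N) = verts (app_iso h (\<Gamma> \<restriction> (u <# N)))"
      by (simp add: h_def image_image)
    have "e \<in> iso_arcs h ` arcs (\<Gamma> \<restriction> (u <# N))" if "e \<in> arcs (\<Gamma> \<restriction> N)" for e
    proof -
      have "e \<in> arcs \<Gamma>" using that by simp
      then show ?thesis
      proof (cases rule: arc_cases)
        case (1 x C c i)
        then show ?thesis
          using that u by (intro image_eqI[of _ _ "(u \<otimes> x, C, c, i)"]) (auto simp: h_def cancel m_assoc mem)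
      qed
    qed
    moreover have "iso_arcs h e \<in> arcs (\<Gamma> \<restriction> N)" if "e \<in> arcs (\<Gamma> \<restriction> (u <# N))" for e
    proof -
      have "e \<in> arcs \<Gamma>" using that by simp
      then show ?thesis
      proof (cases rule: arc_cases)
        case (1 x C c i)
        then show ?thesis
          using that u by (auto simp: h_def m_assoc mem)
      qed
    qed
    ultimately show "arcs (\<Gamma> \<restriction> N) = arcs (app_iso h (\<Gamma> \<restriction> (u <# N)))"
      by auto
  qed (simp_all add: h_def)
  ultimately show ?thesis
    unfolding digraph_iso_def by blast
qed

section \<open>Cosets of \<open>V\<close> as connected components\<close>

abbreviation Q where "Q \<equiv> carrier (G Mod V)"

text \<open>The quotient group consists of right cosets. Normality turns them into left cosets,
  which are the sets stable under the arcs.\<close>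

lemma Q_eq: "Q = (\<lambda>x. x <# V) ` carrier G"
  using normal.coset_eq[OF V_normal] by (auto simp: carrier_FactGroup)

lemma V_in_Q: "V \<in> Q"
  using coset_join3[OF one_closed V_subgroup] subgroup.one_closed[OF V_subgroup] unfolding Q_eq
  by (metis imageI one_closed)

lemma coset_iso: "i \<in> Q \<Longrightarrow> digraph_iso (\<Gamma> \<restriction> i) (\<Gamma> \<restriction> V)"
  using translate_iso subgroup.subset[OF V_subgroup] by (auto simp: Q_eq)

lemma subgraph_induced: "N \<subseteq> carrier G \<Longrightarrow> subgraph (\<Gamma> \<restriction> N) \<Gamma>"
  using \<Gamma>.wf_digraph_axioms wf_induced by (auto simp: subgraph_def compatible_def)

lemma Q_union: "\<Union>Q = carrier G"
  using rcosets_part_G[OF V_subgroup] by (simp add: FactGroup_def)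

lemma Q_disjoint: "i \<in> Q \<Longrightarrow> j \<in> Q \<Longrightarrow> i \<noteq> j \<Longrightarrow> i \<inter> j = {}"
  using rcos_disjoint[OF V_subgroup] by (auto simp: FactGroup_def pairwise_def disjnt_def)

lemma coset_mult_closed: "i \<in> Q \<Longrightarrow> x \<in> i \<Longrightarrow> v \<in> V \<Longrightarrow> x \<otimes> v \<in> i"
  using subgroup.m_closed[OF V_subgroup] subgroup.subset[OF V_subgroup]
  by (auto simp: Q_eq l_coset_def m_assoc subset_iff)

text \<open>The label of an arc lies in \<open>S\<close>, hence in \<open>V\<close>, so an arc never
  leaves its coset.\<close>

lemma union_of_cosets: "\<Gamma> = pre_digraph.Union \<Gamma> ((\<lambda>i. \<Gamma> \<restriction> i) ` Q)"
proof (rule pre_digraph.equality)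
  show "verts \<Gamma> = verts (pre_digraph.Union \<Gamma> ((\<lambda>i. \<Gamma> \<restriction> i) ` Q))"
    using Q_union by (simp add: pre_digraph.Union_def)
  have "\<exists>i\<in>Q. tail \<Gamma> e \<in> i \<and> head \<Gamma> e \<in> i" if "e \<in> arcs \<Gamma>" for e
    using that
  proof (cases rule: arc_cases)
    case (1 x C c k)
    then obtain i where "i \<in> Q" "x \<in> i"
      using Q_union by blast
    then show ?thesis
      using 1 coset_mult_closed[of i x c] A_subset_S S_subset_V by auto
  qed
  then show "arcs \<Gamma> = arcs (pre_digraph.Union \<Gamma> ((\<lambda>i. \<Gamma> \<restriction> i) ` Q))"
    by (auto simp: pre_digraph.Union_def)
qed (simp_all add: pre_digraph.Union_def)

lemma disjoint_union_of_cosets: "is_disjoint_union \<Gamma> Q (\<lambda>i. \<Gamma> \<restriction> i)"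
  unfolding is_disjoint_union_def
  using Q_union Q_disjoint union_of_cosets
  by (auto simp: disjoint_family_on_def intro!: subgraph_induced)

text \<open>Two vertices of a coset differ by some v in \<open>V\<close>, and the path follows the
  generation of v: an element s of \<open>S\<close> is followed forwards, its inverse is the path
  from x \<open>inv s\<close> to x traversed backwards, and products are concatenated.\<close>

lemma connected_coset:
  assumes i: "i \<in> Q"
  shows "connected (\<Gamma> \<restriction> i)"
proof -
  interpret wf_digraph "\<Gamma> \<restriction> i" by (rule wf_induced)
  interpret sym: pair_wf_digraph "mk_symmetric (\<Gamma> \<restriction> i)" by (rule wellformed_mk_symmetric)
  let ?R = "\<lambda>x y. x \<rightarrow>\<^sup>*\<^bsub>with_proj (mk_symmetric (\<Gamma> \<restriction> i))\<^esub> y"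
  have closed: "i \<subseteq> carrier G"
    using i Q_union by blast
  have S: "?R x (x \<otimes> s)" if "x \<in> i" "s \<in> S" for x s
    using that i closed coset_mult_closed S_subset_V
    by (intro reachable_mk_symmetricI reachable_mult) auto
  have V: "?R x (x \<otimes> v)" if "v \<in> V" "x \<in> i" for x v
    using that unfolding V_def
  proof (induction arbitrary: x)
    case one
    then show ?case using closed by (auto simp: subset_iff)
  next
    case (incl s)
    then show ?case by (intro S)
  next
    case (inv s)
    have *: "inv s \<in> V" "s \<in> carrier G" "x \<in> carrier G"
      using inv closed S_closed by (auto simp: V_def generate.inv)
    then have "?R (x \<otimes> inv s) (x \<otimes> inv s \<otimes> s)"
      using inv by (intro S coset_mult_closed[OF i])
    moreover have "x \<otimes> inv s \<otimes> s = x"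
      using * by (simp add: m_assoc)
    ultimately show ?case
      using symmetric_reachable[OF symmetric_mk_symmetric] by metis
  next
    case (eng v w)
    then have "v \<in> V" "w \<in> V" by (auto simp: V_def)
    then have "v \<in> carrier G" "w \<in> carrier G" "x \<in> carrier G" "x \<otimes> v \<in> i"
      using eng.prems closed subgroup.subset[OF V_subgroup] coset_mult_closed[OF i] by auto
    moreover from this have "?R x (x \<otimes> v \<otimes> w)"
      using sym.reachable_trans[OF eng.IH(1)[OF eng.prems] eng.IH(2)[of "x \<otimes> v"]] by blast
    ultimately show ?case
      by (simp add: m_assoc)
  qed
  show ?thesis
    unfolding connected_def strongly_connected_def
  proof (intro conjI ballI)
    show "verts (with_proj (mk_symmetric (\<Gamma> \<restriction> i))) \<noteq> {}"
      using i rcos_self[OF _ V_subgroup] by (auto simp: carrier_FactGroup)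
    fix x y assume "x \<in> verts (with_proj (mk_symmetric (\<Gamma> \<restriction> i)))" "y \<in> verts (with_proj (mk_symmetric (\<Gamma> \<restriction> i)))"
    then have xy: "x \<in> i" "y \<in> i" by auto
    obtain u where u: "u \<in> carrier G" "i = u <# V"
      using i by (auto simp: Q_eq)
    have *: "x \<in> carrier G" "y \<in> carrier G"
      using xy closed by auto
    have "u <# V = x <# V"
      using u xy * mem_l_coset_iff[OF V_subgroup, of u x] l_coset_eq_iff[OF V_subgroup, of u x] by auto
    then have "inv x \<otimes> y \<in> V"
      using u xy * mem_l_coset_iff[OF V_subgroup, of x y] by auto
    moreover have "y = x \<otimes> (inv x \<otimes> y)"
      using * by (simp flip: m_assoc)
    ultimately show "?R x y"
      using V xy by metis
  qed
qed

text \<open>Components are indexed by themselves in \<open>connected_components\<close>. The union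
  indexed by cosets can be reindexed because different induced graphs come from different, hence
  disjoint, cosets.\<close>

lemma Delta_connected_component: "\<Gamma> \<restriction> V \<in> connected_components \<Gamma>"
proof -
  let ?H = "(\<lambda>i. \<Gamma> \<restriction> i) ` Q"
  have "is_disjoint_union \<Gamma> ?H (\<lambda>H. H)"
    using disjoint_union_of_cosets Q_disjoint
    unfolding is_disjoint_union_def disjoint_family_on_def by force
  then show ?thesis
    unfolding connected_components_def using V_in_Q connected_coset by blast
qed

section \<open>Cosets of \<open>U\<close> as strongly connected components\<close>

lemma sccs_eq:
  assumes N: "subgroup N G" "S \<subseteq> N"
  shows "pre_digraph.sccs (\<Gamma> \<restriction> N) = (\<lambda>u. \<Gamma> \<restriction> (u <# U)) ` N"
proof -
  interpret N: subgroup N G by fact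
  interpret wf_digraph "\<Gamma> \<restriction> N" by (rule wf_induced)
  have U: "U \<subseteq> N"
    using U_subset_M M_subset[OF N] by blast
  \<comment> \<open>Mutual reachability of u and v puts both \<open>inv u \<otimes> v\<close> and
    its inverse into \<open>M\<close>, that is, \<open>inv u \<otimes> v\<close> into
    \<open>U\<close>. Since \<open>U\<close> is contained in \<open>N\<close>, the whole coset
    occurs.\<close>
  have cls: "{v. u \<rightarrow>\<^sup>*\<^bsub>\<Gamma> \<restriction> N\<^esub> v \<and> v \<rightarrow>\<^sup>*\<^bsub>\<Gamma> \<restriction> N\<^esub> u} = u <# U" (is "?C = _") if u: "u \<in> N" for u
  proof -
    have inv: "inv v \<otimes> u = inv (inv u \<otimes> v)" if "v \<in> carrier G" for v
      using that u by (simp add: inv_mult_group)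
    have "v \<in> N" if "inv u \<otimes> v \<in> U" "v \<in> carrier G" for v
    proof -
      have "v = u \<otimes> (inv u \<otimes> v)"
        using that u by (simp flip: m_assoc)
      then show ?thesis
        using that u U N.m_closed by (metis subsetD)
    qed
    then have "inv u \<otimes> v \<in> U \<and> v \<in> carrier G \<longleftrightarrow> v \<in> N \<and> inv u \<otimes> v \<in> M \<and> inv v \<otimes> u \<in> M" for v
      using N.mem_carrier by (auto simp: U_def inv)
    then show ?thesis
      using u mem_l_coset_iff[OF U_subgroup N.mem_carrier[OF u]]
      by (auto simp: reachable_iff[OF N])
  qed
  moreover have "u <# U \<subseteq> N" if "u \<in> N" for u
    using that U by (auto simp: l_coset_def)
  ultimately show ?thesis
    unfolding sccs_eq_induced_on_classes by (auto simp: induced_induced intro!: image_cong)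
qed

lemma sccs_Delta: "pre_digraph.sccs (\<Gamma> \<restriction> V) = (\<lambda>u. \<Gamma> \<restriction> (u <# U)) ` V"
  by (rule sccs_eq[OF V_subgroup S_subset_V])

lemma sccs_Gamma: "pre_digraph.sccs \<Gamma> = (\<lambda>u. \<Gamma> \<restriction> (u <# U)) ` carrier G"
  using sccs_eq[OF subgroup_self S_closed] by (simp add: induced_carrier)

lemma U_closed: "U \<subseteq> carrier G"
  using U_subgroup by (rule subgroup.subset)

lemma one_coset_U: "\<one> <# U = U"
  using U_closed by (rule lcos_mult_one)

lemma Lambda_in_sccs: "\<Gamma> \<restriction> U \<in> pre_digraph.sccs (\<Gamma> \<restriction> V)"
  using one_coset_U subgroup.one_closed[OF V_subgroup] unfolding sccs_Delta by (metis image_eqI)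

lemma sccs_iso: "P \<in> pre_digraph.sccs (\<Gamma> \<restriction> V) \<Longrightarrow> digraph_iso P (\<Gamma> \<restriction> U)"
  using translate_iso[OF _ U_closed] subgroup.subset[OF V_subgroup] by (auto simp: sccs_Delta)

lemma inj_induce: "inj_on (\<lambda>N. \<Gamma> \<restriction> N) B"
  by (metis induce_subgraph_verts inj_onI)

text \<open>An induced subgraph determines its vertex set, so counting components amounts to
  counting cosets.\<close>

lemma sccs_eqpoll: "pre_digraph.sccs (\<Gamma> \<restriction> V) \<approx> (\<lambda>u. u <# U) ` V"
proof -
  have "pre_digraph.sccs (\<Gamma> \<restriction> V) = (\<lambda>N. \<Gamma> \<restriction> N) ` (\<lambda>u. u <# U) ` V"
    unfolding sccs_Delta by blast
  then show ?thesis
    using inj_on_image_eqpoll_self[OF inj_induce] by metis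
qed

lemma sccs_eqpoll_quotient: "pre_digraph.sccs (\<Gamma> \<restriction> V) \<approx> carrier (G\<lparr>carrier := V\<rparr> Mod U)"
proof -
  have "carrier (G\<lparr>carrier := V\<rparr> Mod U) = (\<lambda>u. U #> u) ` V"
    by (simp add: carrier_FactGroup r_coset_def)
  also have "\<dots> = (\<lambda>u. u <# U) ` V"
    using normal.coset_eq[OF U_normal] subgroup.subset[OF V_subgroup] by (intro image_cong) auto
  finally show ?thesis
    using sccs_eqpoll by simp
qed

lemma sccs_eqpoll_verts:
  assumes "\<not> submonoid S G"
  shows "pre_digraph.sccs (\<Gamma> \<restriction> V) \<approx> V"
proof -
  have "u <# U = {u}" if "u \<in> V" for u
    using that subgroup.subset[OF V_subgroup] by (auto simp: U_trivial[OF assms] l_coset_def)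
  then have "(\<lambda>u. u <# U) ` V = (\<lambda>u. {u}) ` V"
    by (intro image_cong) auto
  then show ?thesis
    using sccs_eqpoll inj_on_image_eqpoll_self[of "\<lambda>u. {u}" V] eqpoll_trans by (auto simp: inj_on_def)
qed

section \<open>Strong connectedness of \<Delta>\<close>

lemma V_eq_U_iff: "V = U \<longleftrightarrow> S = {} \<or> subgroup S G"
proof
  assume VU: "V = U"
  \<comment> \<open>The inverse of s lies in \<open>M\<close>, so it is 1 or an element of
    \<open>S\<close>; either way 1 is in \<open>S\<close>. Then \<open>M\<close> equals
    \<open>S\<close>, which forces \<open>V = S\<close>.\<close>
  have "subgroup S G" if "s \<in> S" for s
  proof -
    have "inv s \<in> M"
      using that VU S_subset_V by (auto simp: U_def)
    then have "\<one> \<in> S"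
      using that S_mult[of s "inv s"] S_closed by (auto simp: M_def subset_iff)
    then have "V = S"
      using VU U_subset_M S_subset_V by (auto simp: M_def)
    then show ?thesis
      using V_subgroup by simp
  qed
  then show "S = {} \<or> subgroup S G" by blast
next
  assume "S = {} \<or> subgroup S G"
  then have "V \<subseteq> M"
    using generate_empty generate_subgroup_incl[of S S] by (auto simp: V_def M_def)
  then have "V \<subseteq> U"
    using U_unique V_subgroup by blast
  then show "V = U"
    using U_subset_M M_subset[OF V_subgroup S_subset_V] by blast
qed

text \<open>Induced subgraphs agree only if their vertex sets do, so \<open>V\<close> must be a
  coset of \<open>U\<close>; as it contains 1, this coset is \<open>U\<close>.\<close>

lemma Delta_in_sccs_iff: "\<Gamma> \<restriction> V \<in> pre_digraph.sccs \<Gamma> \<longleftrightarrow> S = {} \<or> subgroup S G"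
proof -
  have "\<Gamma> \<restriction> V \<in> pre_digraph.sccs \<Gamma> \<longleftrightarrow> (\<exists>u\<in>carrier G. V = u <# U)"
    unfolding sccs_Gamma by (metis (no_types, lifting) image_iff induce_subgraph_verts)
  also have "\<dots> \<longleftrightarrow> V = U"
  proof
    assume "\<exists>u\<in>carrier G. V = u <# U"
    then obtain u where u: "u \<in> carrier G" "V = u <# U" by blast
    then have "inv u \<in> U"
      using subgroup.one_closed[OF V_subgroup] by (simp add: mem_l_coset_iff[OF U_subgroup])
    then have "u \<in> U"
      using u subgroup.m_inv_closed[OF U_subgroup] by fastforce
    then show "V = U"
      using u coset_join3[OF _ U_subgroup] by simp
  qed (use one_coset_U in auto)
  finally show ?thesis
    by (simp add: V_eq_U_iff)
qed

lemma Delta_in_sccs_finite: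
  assumes "finite S"
  shows "\<Gamma> \<restriction> V \<in> pre_digraph.sccs \<Gamma>"
  using finite_subsemigroup_is_subgroup[OF is_group assms _ S_closed S_mult]
  unfolding Delta_in_sccs_iff by blast

section \<open>The order on the strongly connected components\<close>

lemma scc_ge_iff:
  assumes "u \<in> V" "w \<in> V"
  shows "scc_ge (\<Gamma> \<restriction> V) (\<Gamma> \<restriction> (u <# U)) (\<Gamma> \<restriction> (w <# U)) \<longleftrightarrow> inv u \<otimes> w \<in> M"
proof
  have carr: "u \<in> carrier G" "w \<in> carrier G"
    using assms subgroup.subset[OF V_subgroup] by auto
  assume "scc_ge (\<Gamma> \<restriction> V) (\<Gamma> \<restriction> (u <# U)) (\<Gamma> \<restriction> (w <# U))"
  then obtain a b where ab: "a \<in> U" "b \<in> U" "inv (u \<otimes> a) \<otimes> (w \<otimes> b) \<in> M"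
    by (auto simp: scc_ge_def l_coset_def reachable_iff[OF V_subgroup S_subset_V])
  have ab_carr: "a \<in> carrier G" "b \<in> carrier G"
    using ab U_closed by auto
  \<comment> \<open>Passing from arbitrary vertices of the two components to u and w multiplies by a
    and \<open>inv b\<close>, which lie in \<open>M\<close> because a and b are units of
    \<open>M\<close>.\<close>
  have "inv u \<otimes> w = a \<otimes> (inv (u \<otimes> a) \<otimes> (w \<otimes> b)) \<otimes> inv b"
    using carr ab_carr by (simp add: inv_mult_group m_assoc mult_inv_cancel)
  moreover have "a \<in> M" "inv b \<in> M"
    using ab by (auto simp: U_def)
  ultimately show "inv u \<otimes> w \<in> M"
    using ab M_mult by simp
next
  assume "inv u \<otimes> w \<in> M"
  moreover have "u \<in> u <# U" "w \<in> w <# U"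
    using assms subgroup.subset[OF V_subgroup] subgroup.one_closed[OF U_subgroup]
    by (auto simp: mem_l_coset_iff[OF U_subgroup])
  ultimately show "scc_ge (\<Gamma> \<restriction> V) (\<Gamma> \<restriction> (u <# U)) (\<Gamma> \<restriction> (w <# U))"
    using assms by (auto simp: scc_ge_def reachable_iff[OF V_subgroup S_subset_V])
qed

text \<open>In terms of \<open>M\<close>, reflexivity is \<open>\<one> \<in> M\<close>, transitivity
  is closure under products, and antisymmetry holds because an element of \<open>M\<close> with
  inverse in \<open>M\<close> lies in \<open>U\<close>.\<close>

lemma partial_order_sccs:
  "partial_order_on (pre_digraph.sccs (\<Gamma> \<restriction> V))
    {(x, y). x \<in> pre_digraph.sccs (\<Gamma> \<restriction> V) \<and> y \<in> pre_digraph.sccs (\<Gamma> \<restriction> V) \<and> scc_ge (\<Gamma> \<restriction> V) y x}"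
    (is "partial_order_on ?P ?r")
proof -
  have carr: "u \<in> carrier G" if "u \<in> V" for u
    using that subgroup.subset[OF V_subgroup] by blast
  have "(x, x) \<in> ?r" if "x \<in> ?P" for x
    using that carr M_one by (auto simp: sccs_Delta scc_ge_iff)
  moreover have "trans ?r"
  proof (rule transI)
    fix x y z assume xyz: "(x, y) \<in> ?r" "(y, z) \<in> ?r"
    then obtain u v w where uvw: "u \<in> V" "v \<in> V" "w \<in> V"
      "x = \<Gamma> \<restriction> (u <# U)" "y = \<Gamma> \<restriction> (v <# U)" "z = \<Gamma> \<restriction> (w <# U)"
      unfolding sccs_Delta by blast
    then have "inv v \<otimes> u \<in> M" "inv w \<otimes> v \<in> M"
      using xyz by (auto simp: scc_ge_iff)
    moreover have "inv w \<otimes> u = (inv w \<otimes> v) \<otimes> (inv v \<otimes> u)"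
      using carr uvw by (simp add: m_assoc mult_inv_cancel)
    ultimately show "(x, z) \<in> ?r"
      using xyz uvw M_mult by (auto simp: scc_ge_iff)
  qed
  moreover have "antisym ?r"
  proof (rule antisymI)
    fix x y assume xy: "(x, y) \<in> ?r" "(y, x) \<in> ?r"
    then obtain u v where uv: "u \<in> V" "v \<in> V" "x = \<Gamma> \<restriction> (u <# U)" "y = \<Gamma> \<restriction> (v <# U)"
      unfolding sccs_Delta by blast
    then have "inv v \<otimes> u \<in> M" "inv u \<otimes> v \<in> M"
      using xy by (auto simp: scc_ge_iff)
    moreover have "inv v \<otimes> u = inv (inv u \<otimes> v)"
      using carr uv by (simp add: inv_mult_group)
    ultimately have "inv u \<otimes> v \<in> U"
      by (simp add: U_def)
    then show "x = y"
      using l_coset_eq_iff[OF U_subgroup carr carr, OF uv(1,2)] uv by simp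
  qed
  ultimately show ?thesis
    by (auto simp: partial_order_on_def preorder_on_def refl_on_def)
qed

text \<open>In the commutative case \<open>V\<close> is the group of fractions of \<open>M\<close>,
  with s a denominator of v. The inverse of h has denominator h, and denominators multiply along
  products.\<close>

lemma comm_fraction:
  assumes "comm_group G" "v \<in> V"
  shows "\<exists>s\<in>M. v \<otimes> s \<in> M"
proof -
  interpret comm_group G by fact
  show ?thesis
    using assms(2) unfolding V_def
  proof induction
    case one
    then show ?case using M_one by (auto intro!: bexI[of _ \<one>])
  next
    case (incl h)
    then show ?case
      using S_closed by (intro bexI[of _ \<one>]) (auto simp: M_def subset_iff)
  next
    case (inv h)
    then show ?case
      using S_closed M_one by (intro bexI[of _ h]) (auto simp: M_def subset_iff)
  next
    case (eng v w)
    then obtain s t where st: "s \<in> M" "t \<in> M" "v \<otimes> s \<in> M" "w \<otimes> t \<in> M" by blast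
    have "v \<in> carrier G" "w \<in> carrier G" "s \<in> carrier G" "t \<in> carrier G"
      using eng.hyps st M_closed subgroup.subset[OF V_subgroup] by (auto simp: V_def)
    then have "(v \<otimes> w) \<otimes> (s \<otimes> t) = (v \<otimes> s) \<otimes> (w \<otimes> t)"
      by (simp add: m_ac)
    then show ?case
      using st M_mult by (metis (no_types))
  qed
qed

lemma comm_downward_directed:
  assumes "comm_group G"
  shows "downward_directed (pre_digraph.sccs (\<Gamma> \<restriction> V)) (scc_ge (\<Gamma> \<restriction> V))"
proof -
  interpret V: subgroup V G by (rule V_subgroup)
  have "\<exists>z\<in>V. inv u \<otimes> z \<in> M \<and> inv w \<otimes> z \<in> M" if uw: "u \<in> V" "w \<in> V" for u w
  proof -
    \<comment> \<open>With s a denominator of \<open>inv u \<otimes> w\<close>, the component of ws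
      is a common lower bound of those of u and w.\<close>
    obtain s where s: "s \<in> M" "inv u \<otimes> w \<otimes> s \<in> M"
      using comm_fraction[OF assms, of "inv u \<otimes> w"] uw by auto
    have sV: "s \<in> V"
      using s M_subset[OF V_subgroup S_subset_V] by blast
    then have "inv u \<otimes> (w \<otimes> s) \<in> M" "inv w \<otimes> (w \<otimes> s) \<in> M"
      using s uw by (simp_all add: m_assoc mult_inv_cancel)
    then show ?thesis
      using sV uw by blast
  qed
  then show ?thesis
    unfolding downward_directed_def using partial_order_sccs
    by (auto simp: sccs_Delta scc_ge_iff)
qed

end

theorem theorem2p10:
  fixes G :: "('a, 'm) monoid_scheme"
    and \<rr> :: "'a set \<Rightarrow> nat"
    and K :: "'k::field itself"
  defines "\<Gamma> \<equiv> hopf_graph G \<rr>"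
    and "\<Delta> \<equiv> Delta G \<rr>"
    and "\<Lambda> \<equiv> Lambda G \<rr>"
    and "S \<equiv> hopf_semigroup G \<rr>"
  assumes "group G"
  shows
    "(\<Delta> \<in> connected_components \<Gamma> \<and>
      (\<exists>\<Omega>. is_disjoint_union \<Gamma> (carrier (G Mod verts \<Delta>)) \<Omega> \<and>
           (\<forall>i \<in> carrier (G Mod verts \<Delta>). digraph_iso (\<Omega> i) \<Delta>))) \<and>
     (\<Lambda> \<in> pre_digraph.sccs \<Delta> \<and>
      (\<forall>P \<in> pre_digraph.sccs \<Delta>. digraph_iso P \<Lambda>) \<and>
      (submonoid S G \<longrightarrow>
         pre_digraph.sccs \<Delta> \<approx> carrier (G\<lparr>carrier := verts \<Delta>\<rparr> Mod verts \<Lambda>)) \<and>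
      (\<not> submonoid S G \<longrightarrow> pre_digraph.sccs \<Delta> \<approx> verts \<Delta>)) \<and>
     ((\<Delta> \<in> pre_digraph.sccs \<Gamma> \<longleftrightarrow> ram_zero G \<rr> \<or> subgroup S G) \<and>
      (finite S \<longrightarrow> \<Delta> \<in> pre_digraph.sccs \<Gamma>)) \<and>
     (comm_group G \<longrightarrow> downward_directed (pre_digraph.sccs \<Delta>) (scc_ge \<Delta>)) \<and>
     algebra_isomorphic (leavitt_path_algebra K \<Gamma>)
       (algebra_direct_sum (carrier (G Mod verts \<Delta>)) (leavitt_path_algebra K \<Delta>))"
proof -
  interpret H: ramified_group G \<rr>
    using assms(5) by (simp add: ramified_group_def)
  have "algebra_isomorphic (leavitt_path_algebra K H.\<Gamma>)
      (algebra_direct_sum H.Q (leavitt_path_algebra K (H.\<Gamma> \<restriction> H.V)))"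
    by (rule lpa_disjoint_union_isomorphic[OF H.disjoint_union_of_cosets H.coset_iso
          H.\<Gamma>.wf_digraph_axioms H.wf_induced])
  then show ?thesis
    \<comment> \<open>Once \<Delta> and \<Lambda> are induced subgraphs, their vertex sets become
      \<open>V\<close> and \<open>U\<close>, and every clause is a fact about cosets.\<close>
    unfolding assms(1-4) H.Delta_eq H.Lambda_eq induce_subgraph_verts H.ram_zero_iff
    using H.Delta_connected_component H.disjoint_union_of_cosets H.coset_iso
      H.Lambda_in_sccs H.sccs_iso H.sccs_eqpoll_quotient H.sccs_eqpoll_verts
      H.Delta_in_sccs_iff H.Delta_in_sccs_finite H.comm_downward_directed
    by blast
qed

end
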